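(* There is a universal constant $C<\infty$ such that for every $A,B\ge0$ with $AB<1$ and every integer $n\ge1$, $$\sup_{\eta\in\mathcal{E}_{A,B}}\ \sup_{x\in\mathbb{Z}^2}\bigl(\mathbb{E}_x^\eta\,\Xi_n+\mathbb{E}_x^\eta R_n\bigr)\le C_{A,B}\,\frac{n}{\log(n+2)},\qquad C_{A,B}=C\,\frac{(1+A)(1+B)}{1-AB},$$ where $\Xi_n=\sum_{k<n}|b_k|$ and $R_n=|\{S_0,\ldots,S_{n-1}\}|$. The same bound holds conditionally after any almost surely finite stopping time $T$ of $(\mathcal{F}_n)_{n\ge 0}$: for all such $\eta$, $x$, $n$, almost surely, $$\mathbb{E}_x^\eta\Bigl[\sum_{j<n}|b_{T+j}|+\bigl|\{S_T,\ldots,S_{T+n-1}\}\bigr|\ \Big|\ \mathcal{F}_T\Bigr]\le C_{A,B}\,\frac{n}{\log(n+2)}.$$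
   Context: A cookie environment is a deterministic family $\eta=(\beta_{z,j}: z\in\mathbb{Z}^2, j\ge 1)$ with $\beta_{z,j}\in[-1,1]$. Given $\eta$ and $x\in\mathbb{Z}^2$, the walk $S=(S_n)_{n\ge0}$ is the nearest-neighbour process on $\mathbb{Z}^2$ with $S_0=x$, law $\mathbb{P}_x^\eta$ (expectation $\mathbb{E}_x^\eta$), and conditional step law as follows. Put $e_1=(1,0)$, $e_2=(0,1)$, $\mathcal{F}_n=\sigma(S_0,\ldots,S_n)$, $L_n(z)=\sum_{k<n}\mathbf{1}_{\{S_k=z\}}$, and $b_n=\beta_{S_n,L_n(S_n)+1}$. Then $$\mathbb{P}_x^\eta(S_{n+1}-S_n=e\mid\mathcal{F}_n)=\begin{cases}(1+b_n)/4,& e=\pm e_1,\\(1-b_n)/4,& e=\pm e_2.\end{cases}$$ With $t_+=\max(t,0)$, $t_-=\max(-t,0)$, for $A,B\ge0$ the set $\mathcal{E}_{A,B}$ consists of all environments with $\sum_{j\ge1}(\beta_{z,j})_+\le A$ and $\sum_{j\ge1}(\beta_{z,j})_-\le B$ for every $z\in\mathbb{Z}^2$. *)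

theory Defs
  imports "HOL-Probability.Probability"
begin

type_synonym site = "int \<times> int"
type_synonym path = "nat \<Rightarrow> site"

text \<open>In an environment \<open>\<beta> :: environment\<close> the cookies at a site are numbered from 1; the value
  \<open>\<beta> z 0\<close> is junk that no definition below reads.\<close>

type_synonym environment = "site \<Rightarrow> nat \<Rightarrow> real"

definition cookie_env :: "environment \<Rightarrow> bool"
  where "cookie_env \<beta> \<longleftrightarrow> (\<forall>z. \<forall>j\<ge>1. \<beta> z j \<in> {-1..1})"

text \<open>The sums are taken in \<^typ>\<open>ennreal\<close>, so a divergent series has the value \<open>\<infinity>\<close>.\<close>

definition cookie_envs :: "real \<Rightarrow> real \<Rightarrow> environment set"
  where "cookie_envs A B = {\<beta>. cookie_env \<beta> \<and>
    (\<forall>z. (\<Sum>j. ennreal (max (\<beta> z (Suc j)) 0)) \<le> ennreal A \<and>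
         (\<Sum>j. ennreal (max (- \<beta> z (Suc j)) 0)) \<le> ennreal B)}"

definition path_space :: "path measure"
  where "path_space = Pi\<^sub>M UNIV (\<lambda>_. count_space UNIV)"

text \<open>The time index is \<^typ>\<open>enat\<close>, so that stopping times may take the value \<open>\<infinity>\<close>;
  \<open>walk_filtration \<infinity>\<close> is the \<open>\<sigma>\<close>-algebra generated by the whole path.\<close>

definition walk_filtration :: "enat \<Rightarrow> path measure"
  where "walk_filtration t = sigma UNIV {{\<omega>. \<omega> k \<in> B} | k B. enat k \<le> t}"

definition local_time :: "nat \<Rightarrow> site \<Rightarrow> path \<Rightarrow> nat"
  where "local_time n z \<omega> = (\<Sum>k<n. of_bool (\<omega> k = z))"

text \<open>The cookie \<open>b\<^sub>n\<close> that is eaten at time \<open>n\<close>:\<close>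

definition cookie :: "environment \<Rightarrow> nat \<Rightarrow> path \<Rightarrow> real"
  where "cookie \<beta> n \<omega> = \<beta> (\<omega> n) (local_time n (\<omega> n) \<omega> + 1)"

definition step_prob :: "real \<Rightarrow> site \<Rightarrow> real"
  where "step_prob b e =
    (if e \<in> {(1, 0), - (1, 0)} then (1 + b) / 4
     else if e \<in> {(0, 1), - (0, 1)} then (1 - b) / 4
     else 0)"

text \<open>The law is a measure on path space under which the coordinate process is the walk. The step law
  is required for every \<open>e\<close>; for \<open>e\<close> not a unit vector it says that the walk is nearest-neighbour.
  Existence and uniqueness for \<open>cookie_env \<beta>\<close> are proved below, so \<open>walk_law\<close> is well-defined.\<close>

definition is_walk_law :: "environment \<Rightarrow> site \<Rightarrow> path measure \<Rightarrow> bool"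
  where "is_walk_law \<beta> x P \<longleftrightarrow>
    prob_space P \<and> sets P = sets path_space \<and> (AE \<omega> in P. \<omega> 0 = x) \<and>
    (\<forall>n e. AE \<omega> in P.
       real_cond_exp P (walk_filtration (enat n)) (indicator {\<omega>. \<omega> (Suc n) - \<omega> n = e}) \<omega>
         = step_prob (cookie \<beta> n \<omega>) e)"

definition walk_law :: "environment \<Rightarrow> site \<Rightarrow> path measure"
  where "walk_law \<beta> x = (THE P. is_walk_law \<beta> x P)"

text \<open>\<open>total_drift \<beta> m n\<close> and \<open>range_size m n\<close> refer to the \<open>n\<close> times \<open>m, \<dots>, m + n - 1\<close>;
  with \<open>m = 0\<close> they are \<open>\<Xi>\<^sub>n\<close> and \<open>R\<^sub>n\<close>.\<close>

definition total_drift :: "environment \<Rightarrow> nat \<Rightarrow> nat \<Rightarrow> path \<Rightarrow> real"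
  where "total_drift \<beta> m n \<omega> = (\<Sum>j<n. \<bar>cookie \<beta> (m + j) \<omega>\<bar>)"

definition range_size :: "nat \<Rightarrow> nat \<Rightarrow> path \<Rightarrow> nat"
  where "range_size m n \<omega> = card ((\<lambda>j. \<omega> (m + j)) ` {..<n})"

subsection \<open>The filtration\<close>

lemma space_path_space [simp]: "space path_space = UNIV"
  by (simp add: path_space_def space_PiM)

lemma space_walk_filtration [simp]: "space (walk_filtration t) = UNIV"
  by (simp add: walk_filtration_def space_measure_of_conv)

lemma sets_walk_filtration:
  "sets (walk_filtration t) = sigma_sets UNIV {{\<omega>. \<omega> k \<in> B} | k B. enat k \<le> t}"
  by (simp add: walk_filtration_def)

global_interpretation walk: filtration UNIV walk_filtration
proof
  show "sets (walk_filtration s) \<subseteq> sets (walk_filtration t)" if "s \<le> t" for s t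
    unfolding sets_walk_filtration using that by (intro sigma_sets_subseteq) (auto intro: order_trans)
qed simp

lemma sets_walk_filtration_infinity: "sets (walk_filtration \<infinity>) = sets path_space"
  by (simp add: sets_walk_filtration path_space_def sets_PiM_single)

lemma sets_walk_filtration_subset: "sets (walk_filtration t) \<subseteq> sets path_space"
  using walk.sets_F_mono[of t \<infinity>] by (simp add: sets_walk_filtration_infinity)

definition history :: "nat \<Rightarrow> path \<Rightarrow> site list"
  where "history n \<omega> = map \<omega> [0..<Suc n]"

lemma history_eq_iff: "history n \<omega> = history n \<omega>' \<longleftrightarrow> (\<forall>k\<le>n. \<omega> k = \<omega>' k)"
  unfolding history_def map_eq_conv by (auto simp del: upt_Suc)

lemma measurable_history: "history n \<in> walk_filtration (enat n) \<rightarrow>\<^sub>M count_space UNIV"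
proof (rule measurable_count_space_eq2_countable[THEN iffD2])
  show "history n \<in> space (walk_filtration (enat n)) \<rightarrow> UNIV \<and>
    (\<forall>a\<in>UNIV. history n -` {a} \<inter> space (walk_filtration (enat n)) \<in> sets (walk_filtration (enat n)))"
  proof safe
    fix l :: "site list"
    show "history n -` {l} \<inter> space (walk_filtration (enat n)) \<in> sets (walk_filtration (enat n))"
    proof (cases "length l = Suc n")
      case True
      then have "history n -` {l} \<inter> space (walk_filtration (enat n)) = (\<Inter>k\<in>{..n}. {\<omega>. \<omega> k \<in> {l ! k}})"
        by (auto simp: history_def list_eq_iff_nth_eq less_Suc_eq_le simp del: upt_Suc)
      also have "\<dots> \<in> sets (walk_filtration (enat n))"
      proof (intro sets.finite_INT)
        fix k assume "k \<in> {..n}"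
        then show "{\<omega>. \<omega> k \<in> {l ! k}} \<in> sets (walk_filtration (enat n))"
          unfolding sets_walk_filtration by (intro sigma_sets.Basic) force
      qed auto
      finally show ?thesis .
    next
      case False
      then have "history n -` {l} = {}" by (auto simp: history_def)
      then show ?thesis by simp
    qed
  qed auto
qed

lemma walk_filtration_history:
  assumes "A \<in> sets (walk_filtration (enat n))"
  obtains L where "A = history n -` L"
proof -
  have "\<exists>L. A = history n -` L"
    using assms unfolding sets_walk_filtration
  proof induction
    case (Basic a)
    then obtain k B where "a = {\<omega>. \<omega> k \<in> B}" "k \<le> n" by auto
    then have "a = history n -` {l. l ! k \<in> B}"
      by (auto simp: history_def less_Suc_eq_le simp del: upt_Suc)
    then show ?case by blast
  next
    case Empty
    show ?case by (rule exI[of _ "{}"]) simp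
  next
    case (Compl a)
    then obtain L where "a = history n -` L" by blast
    then have "UNIV - a = history n -` (- L)" by auto
    then show ?case by blast
  next
    case (Union a)
    then obtain L where "\<And>i. a i = history n -` (L i)" by metis
    then have "\<Union>(range a) = history n -` (\<Union>i. L i)" by auto
    then show ?case by blast
  qed
  then show ?thesis using that by blast
qed

lemma local_time_cong: "(\<And>k. k < n \<Longrightarrow> \<omega> k = \<omega>' k) \<Longrightarrow> local_time n z \<omega> = local_time n z \<omega>'"
  by (simp add: local_time_def)

lemma cookie_cong:
  assumes "\<And>k. k \<le> n \<Longrightarrow> \<omega> k = \<omega>' k"
  shows "cookie \<beta> n \<omega> = cookie \<beta> n \<omega>'"
proof -
  have "local_time n z \<omega> = local_time n z \<omega>'" for z
    by (rule local_time_cong) (simp add: assms)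
  moreover have "\<omega> n = \<omega>' n" by (rule assms) simp
  ultimately show ?thesis by (simp add: cookie_def)
qed

lemma measurable_by_history:
  fixes f :: "path \<Rightarrow> 'a"
  assumes "\<And>\<omega> \<omega>'. (\<And>k. k \<le> n \<Longrightarrow> \<omega> k = \<omega>' k) \<Longrightarrow> f \<omega> = f \<omega>'" and "space M = UNIV"
  shows "f \<in> walk_filtration (enat n) \<rightarrow>\<^sub>M M"
proof -
  have "(\<lambda>\<omega>. (\<lambda>l. f (\<lambda>k. l ! k)) (history n \<omega>)) \<in> walk_filtration (enat n) \<rightarrow>\<^sub>M M"
    by (rule measurable_compose[OF measurable_history]) (simp add: assms(2))
  moreover have "f = (\<lambda>\<omega>. f (\<lambda>k. history n \<omega> ! k))"
    by (rule ext, rule assms(1)) (simp add: history_def less_Suc_eq_le del: upt_Suc)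
  ultimately show ?thesis by simp
qed

lemma measurable_path_by_history:
  fixes f :: "path \<Rightarrow> 'a"
  assumes "\<And>\<omega> \<omega>'. (\<And>k. k \<le> n \<Longrightarrow> \<omega> k = \<omega>' k) \<Longrightarrow> f \<omega> = f \<omega>'" and "space M = UNIV"
    and "sets P = sets path_space"
  shows "f \<in> P \<rightarrow>\<^sub>M M"
proof -
  have "space P = UNIV" using sets_eq_imp_space_eq[OF assms(3)] by simp
  moreover have "f \<in> walk_filtration (enat n) \<rightarrow>\<^sub>M M"
    by (rule measurable_by_history) fact+
  ultimately show ?thesis
    using sets_walk_filtration_subset[of "enat n"] assms(3) by (auto simp: measurable_def)
qed

subsection \<open>Existence and uniqueness of the walk law\<close>

text \<open>The definition through conditional expectations is equivalent to the product formula for the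
  probabilities of finite path segments.\<close>

definition cyl :: "nat \<Rightarrow> path \<Rightarrow> path set"
  where "cyl n c = {\<omega>. \<forall>k\<le>n. \<omega> k = c k}"

lemma cyl_sets_filtration: "cyl n c \<in> sets (walk_filtration (enat n))"
proof -
  have "(\<lambda>\<omega>. \<forall>k\<le>n. \<omega> k = c k) \<in> walk_filtration (enat n) \<rightarrow>\<^sub>M count_space UNIV"
    by (rule measurable_by_history) auto
  from measurable_sets[OF this, of "{True}"] show ?thesis by (simp add: cyl_def vimage_def)
qed

lemma cyl_sets: "cyl n c \<in> sets path_space"
  using cyl_sets_filtration sets_walk_filtration_subset by blast

lemma subalgebra_walk_filtration:
  assumes "sets P = sets path_space"
  shows "subalgebra P (walk_filtration t)"
  using assms sets_walk_filtration_subset sets_eq_imp_space_eq[OF assms]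
  by (auto simp: subalgebra_def)

lemma cookie_bounds:
  assumes "cookie_env \<beta>"
  shows "-1 \<le> cookie \<beta> n \<omega>" "cookie \<beta> n \<omega> \<le> 1"
proof -
  have "\<beta> (\<omega> n) (local_time n (\<omega> n) \<omega> + 1) \<in> {-1..1}"
    using assms unfolding cookie_env_def by (metis le_add2)
  then show "-1 \<le> cookie \<beta> n \<omega>" "cookie \<beta> n \<omega> \<le> 1" by (auto simp: cookie_def)
qed

lemma step_prob_bounds:
  assumes "cookie_env \<beta>"
  shows "0 \<le> step_prob (cookie \<beta> n \<omega>) e" "step_prob (cookie \<beta> n \<omega>) e \<le> 1"
  using cookie_bounds[OF assms, of n \<omega>] by (auto simp: step_prob_def)

lemma nn_integral_step_prob:
  assumes b: "-1 \<le> b" "b \<le> 1"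
  shows "(\<integral>\<^sup>+y. ennreal (step_prob b (y - z)) \<partial>count_space UNIV) = 1"
proof -
  define E where "E = ({(1, 0), (-1, 0), (0, 1), (0, -1)} :: site set)"
  have step_0: "step_prob b e = 0" if "e \<notin> E" for e
    using that by (simp add: step_prob_def E_def)
  have "(\<integral>\<^sup>+y. ennreal (step_prob b (y - z)) \<partial>count_space UNIV)
      = (\<Sum>y\<in>(+) z ` E. ennreal (step_prob b (y - z)))"
  proof (rule nn_integral_count_space')
    fix y assume "y \<notin> (+) z ` E"
    then have "y - z \<notin> E" by (metis diff_add_cancel add.commute imageI)
    from step_0[OF this] show "ennreal (step_prob b (y - z)) = 0" by simp
  qed (simp_all add: E_def)
  also have "\<dots> = (\<Sum>e\<in>E. ennreal (step_prob b e))"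
    by (subst sum.reindex) (simp_all only: inj_on_add o_def add_diff_cancel_left')
  also have "\<dots> = ennreal (\<Sum>e\<in>E. step_prob b e)"
    by (rule sum_ennreal) (use b in \<open>simp add: step_prob_def\<close>)
  also have "(\<Sum>e\<in>E. step_prob b e) = 1"
    by (simp add: step_prob_def E_def field_simps)
  finally show ?thesis by simp
qed

lemma walk_law_cyl_Suc:
  assumes env: "cookie_env \<beta>" and P: "is_walk_law \<beta> x P"
  shows "measure P (cyl (Suc n) c) =
    step_prob (cookie \<beta> n c) (c (Suc n) - c n) * measure P (cyl n c)"
proof -
  interpret prob_space P using P by (simp add: is_walk_law_def)
  have sets: "sets P = sets path_space" using P by (simp add: is_walk_law_def)
  interpret finite_measure_subalgebra P "walk_filtration (enat n)"
    by unfold_locales (rule subalgebra_walk_filtration[OF sets])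
  have sp: "space P = UNIV" using sets_eq_imp_space_eq[OF sets] by simp
  let ?e = "c (Suc n) - c n"
  let ?D = "{\<omega>. \<omega> (Suc n) - \<omega> n = ?e} :: path set"
  let ?p = "step_prob (cookie \<beta> n c) ?e"
  have "(\<lambda>\<omega>. \<omega> (Suc n) - \<omega> n = ?e) \<in> P \<rightarrow>\<^sub>M count_space UNIV"
    by (rule measurable_path_by_history[of "Suc n"]) (auto simp: sets)
  from measurable_sets[OF this, of "{True}"] have D: "?D \<in> sets P" by (simp add: vimage_def sp)
  have cy: "cyl n c \<in> sets P" by (simp add: sets cyl_sets)
  have int: "integrable P (indicator ?D :: path \<Rightarrow> real)"
    using D by (simp add: emeasure_eq_measure)
  have "measure P (cyl (Suc n) c) = measure P (cyl n c \<inter> ?D)"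
    by (rule arg_cong[of _ _ "measure P"]) (auto simp: cyl_def le_Suc_eq)
  also have "\<dots> = (\<integral>\<omega>\<in>cyl n c. indicator ?D \<omega> \<partial>P)"
    using cy D by (simp add: set_lebesgue_integral_def flip: indicator_inter_arith)
  also have "\<dots> = (\<integral>\<omega>\<in>cyl n c. real_cond_exp P (walk_filtration (enat n)) (indicator ?D) \<omega> \<partial>P)"
    by (rule real_cond_exp_intA[OF int cyl_sets_filtration])
  also have "\<dots> = (\<integral>\<omega>. ?p * indicator (cyl n c) \<omega> \<partial>P)"
    unfolding set_lebesgue_integral_def
  proof (rule integral_cong_AE)
    have "AE \<omega> in P. real_cond_exp P (walk_filtration (enat n)) (indicator ?D) \<omega>
        = step_prob (cookie \<beta> n \<omega>) ?e"
      using P unfolding is_walk_law_def by blast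
    then show "AE \<omega> in P. indicator (cyl n c) \<omega> *\<^sub>R
        real_cond_exp P (walk_filtration (enat n)) (indicator ?D) \<omega> = ?p * indicator (cyl n c) \<omega>"
    proof eventually_elim
      case (elim \<omega>)
      then show ?case
        using cookie_cong[of n \<omega> c \<beta>] by (auto simp: cyl_def split: split_indicator)
    qed
  qed (use cy in measurable)
  also have "\<dots> = ?p * measure P (cyl n c)"
    using cy by simp
  finally show ?thesis .
qed

lemma is_walk_lawI:
  assumes env: "cookie_env \<beta>" and "prob_space P" and sets: "sets P = sets path_space"
    and init: "AE \<omega> in P. \<omega> 0 = x"
    and step: "\<And>n c. measure P (cyl (Suc n) c) =
      step_prob (cookie \<beta> n c) (c (Suc n) - c n) * measure P (cyl n c)"
  shows "is_walk_law \<beta> x P"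
  unfolding is_walk_law_def
proof (intro conjI allI)
  interpret prob_space P by fact
  have sp: "space P = UNIV" using sets_eq_imp_space_eq[OF sets] by simp
  fix n e
  interpret finite_measure_subalgebra P "walk_filtration (enat n)"
    by unfold_locales (rule subalgebra_walk_filtration[OF sets])
  let ?D = "{\<omega>. \<omega> (Suc n) - \<omega> n = e} :: path set"
  let ?p = "\<lambda>\<omega>. step_prob (cookie \<beta> n \<omega>) e"
  have "(\<lambda>\<omega>. \<omega> (Suc n) - \<omega> n = e) \<in> P \<rightarrow>\<^sub>M count_space UNIV"
    by (rule measurable_path_by_history[of "Suc n"]) (auto simp: sets)
  from measurable_sets[OF this, of "{True}"] have D: "?D \<in> sets P" by (simp add: vimage_def sp)
  have int: "integrable P (indicator ?D :: path \<Rightarrow> real)"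
    using D by (simp add: emeasure_eq_measure)
  have p_cong: "?p \<omega> = ?p \<omega>'" if "\<And>k. k \<le> n \<Longrightarrow> \<omega> k = \<omega>' k" for \<omega> \<omega>'
    using cookie_cong[of n \<omega> \<omega>'] that by simp
  have pF: "?p \<in> borel_measurable (walk_filtration (enat n))"
    by (rule measurable_by_history) (auto intro: p_cong)
  have pP[measurable]: "?p \<in> borel_measurable P"
    by (rule measurable_path_by_history[of n]) (auto intro: p_cong simp: sets)
  have pint: "integrable P ?p"
    by (rule integrable_const_bound[of _ 1])
       (use step_prob_bounds[OF env] in \<open>auto simp: abs_le_iff intro!: AE_I2 order_trans[of _ 0]\<close>)
  have hist[measurable]: "history n \<in> P \<rightarrow>\<^sub>M count_space UNIV"
    by (rule measurable_path_by_history[of n]) (auto simp: sets history_eq_iff)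
  let ?H = "\<lambda>f. distr (density P f) (count_space UNIV) (history n)"
  have eqH: "?H (indicator ?D) = ?H (\<lambda>\<omega>. ennreal (?p \<omega>))"
  proof (rule measure_eqI_countable[of _ UNIV])
    fix l :: "site list"
    show "emeasure (?H (indicator ?D)) {l} = emeasure (?H (\<lambda>\<omega>. ennreal (?p \<omega>))) {l}"
    proof (cases "history n -` {l} = {}")
      case True
      then show ?thesis by (simp add: emeasure_distr sp)
    next
      case False
      then obtain c0 where c0: "history n c0 = l" by auto
      define c where "c = c0(Suc n := c0 n + e)"
      have c: "history n -` {l} = cyl n c"
        by (auto simp: c_def cyl_def history_eq_iff c0[symmetric])
      have cs: "c (Suc n) - c n = e" by (simp add: c_def)
      have cy: "cyl n c \<in> sets P" by (simp add: sets cyl_sets)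
      have "emeasure (?H (indicator ?D)) {l} = (\<integral>\<^sup>+\<omega>. indicator ?D \<omega> * indicator (cyl n c) \<omega> \<partial>P)"
        using D cy by (simp add: emeasure_distr sp c emeasure_density)
      also have "\<dots> = emeasure P (?D \<inter> cyl n c)"
        using D cy by (simp flip: indicator_inter_arith)
      also have "?D \<inter> cyl n c = cyl (Suc n) c"
        using cs by (auto simp: cyl_def le_Suc_eq)
      also have "emeasure P \<dots> = ennreal (?p c) * emeasure P (cyl n c)"
        using step[of n c] cs step_prob_bounds[OF env, of n c e]
        by (simp add: emeasure_eq_measure ennreal_mult'')
      also have "\<dots> = (\<integral>\<^sup>+\<omega>. ennreal (?p c) * indicator (cyl n c) \<omega> \<partial>P)"
        using cy by (simp add: nn_integral_cmult_indicator)
      also have "\<dots> = (\<integral>\<^sup>+\<omega>. ennreal (?p \<omega>) * indicator (cyl n c) \<omega> \<partial>P)"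
        by (intro nn_integral_cong) (auto simp: cyl_def split: split_indicator intro!: arg_cong[of _ _ ennreal] p_cong)
      also have "\<dots> = emeasure (?H (\<lambda>\<omega>. ennreal (?p \<omega>))) {l}"
        using cy by (simp add: emeasure_distr sp c emeasure_density)
      finally show ?thesis .
    qed
  qed auto
  show "AE \<omega> in P. real_cond_exp P (walk_filtration (enat n)) (indicator ?D) \<omega> = ?p \<omega>"
  proof (rule real_cond_exp_charact[OF _ int pint pF])
    fix A assume AF: "A \<in> sets (walk_filtration (enat n))"
    then have A[measurable]: "A \<in> sets P" using sets_walk_filtration_subset sets by blast
    obtain L where L: "A = history n -` L" using walk_filtration_history[OF AF] .
    have "(\<integral>\<^sup>+\<omega>. indicator ?D \<omega> * indicator A \<omega> \<partial>P) = emeasure (?H (indicator ?D)) L"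
      using D A by (simp add: emeasure_distr sp L[symmetric] emeasure_density)
    also have "\<dots> = (\<integral>\<^sup>+\<omega>. ennreal (?p \<omega>) * indicator A \<omega> \<partial>P)"
      unfolding eqH using A by (simp add: emeasure_distr sp L[symmetric] emeasure_density)
    finally have *: "(\<integral>\<^sup>+\<omega>. ennreal (indicator ?D \<omega> * indicator A \<omega>) \<partial>P)
        = (\<integral>\<^sup>+\<omega>. ennreal (?p \<omega> * indicator A \<omega>) \<partial>P)"
      by (simp add: ennreal_mult'' ennreal_indicator)
    show "(\<integral>\<omega>\<in>A. indicator ?D \<omega> \<partial>P) = (\<integral>\<omega>\<in>A. ?p \<omega> \<partial>P)"
      unfolding set_lebesgue_integral_def using D
      by (subst (1 2) integral_eq_nn_integral)
         (auto simp: step_prob_bounds[OF env] * mult.commute[of "indicator A _"])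
  qed
qed (use assms in auto)

lemma walk_law_unique:
  assumes env: "cookie_env \<beta>" and P: "is_walk_law \<beta> x P" and Q: "is_walk_law \<beta> x Q"
  shows "P = Q"
proof -
  interpret P: prob_space P using P by (simp add: is_walk_law_def)
  interpret Q: prob_space Q using Q by (simp add: is_walk_law_def)
  have sets: "sets P = sets path_space" "sets Q = sets path_space"
    using P Q by (simp_all add: is_walk_law_def)
  have sp: "space P = UNIV" "space Q = UNIV" using sets[THEN sets_eq_imp_space_eq] by simp_all
  have cyl0: "measure R (cyl 0 c) = of_bool (c 0 = x)" if R: "is_walk_law \<beta> x R" for R c
  proof -
    interpret R: prob_space R using R by (simp add: is_walk_law_def)
    have sR: "sets R = sets path_space" using R by (simp add: is_walk_law_def)
    have AE: "AE \<omega> in R. \<omega> 0 = x" using R by (simp add: is_walk_law_def)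
    have cy: "cyl 0 c \<in> sets R" by (simp add: sR cyl_sets)
    show ?thesis
    proof (cases "c 0 = x")
      case True
      with AE have "AE \<omega> in R. \<omega> \<in> cyl 0 c" by (auto simp: cyl_def)
      with True show ?thesis using R.prob_eq_1[OF cy] by simp
    next
      case False
      with AE have "AE \<omega> in R. \<omega> \<notin> cyl 0 c" by (auto simp: cyl_def)
      with False show ?thesis using R.prob_eq_0[OF cy] by simp
    qed
  qed
  have eq: "measure P (cyl n c) = measure Q (cyl n c)" for n c
    by (induction n) (simp_all add: cyl0[OF P] cyl0[OF Q] walk_law_cyl_Suc[OF env P] walk_law_cyl_Suc[OF env Q])
  have hist: "history n \<in> R \<rightarrow>\<^sub>M count_space UNIV" if "sets R = sets path_space" for n R
    by (rule measurable_path_by_history[of n]) (auto simp: that history_eq_iff)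
  have eqH: "distr P (count_space UNIV) (history n) = distr Q (count_space UNIV) (history n)" for n
  proof (rule measure_eqI_countable[of _ UNIV])
    fix l :: "site list"
    have "history n -` {l} = {} \<or> (\<exists>c. history n -` {l} = cyl n c)"
      by (auto simp: cyl_def history_eq_iff)
    then show "emeasure (distr P (count_space UNIV) (history n)) {l}
        = emeasure (distr Q (count_space UNIV) (history n)) {l}"
      using eq by (auto simp: emeasure_distr hist sets sp P.emeasure_eq_measure Q.emeasure_eq_measure)
  qed auto
  have eqF: "emeasure P A = emeasure Q A" if AF: "A \<in> sets (walk_filtration (enat n))" for A n
  proof -
    obtain L where L: "A = history n -` L" using walk_filtration_history[OF AF] .
    have "emeasure P A = emeasure (distr P (count_space UNIV) (history n)) L"
      by (simp add: emeasure_distr hist sets sp L)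
    also have "\<dots> = emeasure Q A"
      unfolding eqH by (simp add: emeasure_distr hist sets sp L)
    finally show ?thesis .
  qed
  let ?G = "\<Union>n. sets (walk_filtration (enat n))"
  have G: "sets path_space = sigma_sets UNIV ?G"
  proof
    have "{{\<omega>. \<omega> k \<in> B} | k B. enat k \<le> \<infinity>} \<subseteq> ?G"
      by (auto simp: sets_walk_filtration intro!: sigma_sets.Basic)
    then show "sets path_space \<subseteq> sigma_sets UNIV ?G"
      unfolding sets_walk_filtration_infinity[symmetric] sets_walk_filtration[of \<infinity>]
      by (rule sigma_sets_subseteq)
    show "sigma_sets UNIV ?G \<subseteq> sets path_space"
      using sets.sigma_sets_subset[of ?G path_space] sets_walk_filtration_subset by auto
  qed
  show ?thesis
  proof (rule measure_eqI_generator_eq[where E = ?G and \<Omega> = UNIV and A = "\<lambda>_. UNIV"])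
    show "Int_stable ?G"
    proof (rule Int_stableI)
      fix a b assume "a \<in> ?G" "b \<in> ?G"
      then obtain m n where "a \<in> sets (walk_filtration (enat m))" "b \<in> sets (walk_filtration (enat n))"
        by blast
      then have "a \<in> sets (walk_filtration (enat (max m n)))" "b \<in> sets (walk_filtration (enat (max m n)))"
        using walk.sets_F_mono[of "enat m" "enat (max m n)"] walk.sets_F_mono[of "enat n" "enat (max m n)"]
        by auto
      then show "a \<inter> b \<in> ?G" by blast
    qed
    show "range (\<lambda>_::nat. UNIV) \<subseteq> ?G"
      using sets.top[of "walk_filtration (enat 0)"] by auto
  qed (auto simp: G sets eqF)
qed

lemma walk_law_exists:
  assumes env: "cookie_env \<beta>"
  shows "\<exists>P. is_walk_law \<beta> x P"
proof -
  define M where "M = (\<lambda>_::nat. count_space (UNIV :: site set))"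
  define K where "K n \<omega> = (if n = 0 then return (count_space UNIV) x else
      point_measure UNIV (\<lambda>y. ennreal (step_prob (cookie \<beta> (n - 1) \<omega>) (y - \<omega> (n - 1)))))"
    for n and \<omega> :: path
  have spM: "space (M i) = UNIV" for i by (simp add: M_def)
  have probK: "prob_space (K n \<omega>)" for n \<omega>
  proof (cases "n = 0")
    case True
    then show ?thesis by (simp add: K_def prob_space_return)
  next
    case False
    have "(\<integral>\<^sup>+y. ennreal (step_prob (cookie \<beta> (n - 1) \<omega>) (y - \<omega> (n - 1))) \<partial>count_space UNIV) = 1"
      by (rule nn_integral_step_prob[OF cookie_bounds[OF env]])
    then have "emeasure (K n \<omega>) (space (K n \<omega>)) = 1"
      unfolding K_def if_not_P[OF False] by (simp add: point_measure_def emeasure_density)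
    then show ?thesis by (rule prob_spaceI)
  qed
  have setsK: "sets (K n \<omega>) = UNIV" for n \<omega>
    by (cases "n = 0") (simp_all add: K_def point_measure_def)
  have K_cong: "K n \<omega> = K n \<omega>'" if "\<And>k. k < n \<Longrightarrow> \<omega> k = \<omega>' k" for n \<omega> \<omega>'
  proof (cases n)
    case (Suc m)
    then have "cookie \<beta> m \<omega> = cookie \<beta> m \<omega>'" by (intro cookie_cong that) simp
    moreover have "\<omega> m = \<omega>' m" using Suc by (intro that) simp
    ultimately show ?thesis by (simp add: K_def Suc)
  qed (simp add: K_def)
  have measK: "K n \<in> PiM {0..<n} M \<rightarrow>\<^sub>M subprob_algebra (M n)" for n
  proof -
    let ?R = "PiM {0..<n} M" and ?h = "\<lambda>\<omega> :: path. map \<omega> [0..<n]"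
    have atom: "?h -` {l} \<inter> space ?R \<in> sets ?R" for l
    proof (cases "length l = n")
      case True
      have "?h -` {l} \<inter> space ?R = (\<Pi>\<^sub>E k\<in>{0..<n}. {l ! k})"
      proof (rule set_eqI)
        fix \<omega> :: path
        have "map \<omega> [0..<n] = l \<longleftrightarrow> (\<forall>k<n. \<omega> k = l ! k)"
          using True by (simp add: list_eq_iff_nth_eq)
        moreover have "\<omega> \<in> space ?R \<longleftrightarrow> \<omega> \<in> extensional {0..<n}"
          by (simp add: space_PiM spM PiE_iff)
        moreover have "\<omega> \<in> (\<Pi>\<^sub>E k\<in>{0..<n}. {l ! k}) \<longleftrightarrow> (\<forall>k<n. \<omega> k = l ! k) \<and> \<omega> \<in> extensional {0..<n}"
          by (simp add: PiE_iff Ball_def)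
        ultimately show "\<omega> \<in> ?h -` {l} \<inter> space ?R \<longleftrightarrow> \<omega> \<in> (\<Pi>\<^sub>E k\<in>{0..<n}. {l ! k})"
          by (simp only: vimage_singleton_eq Int_iff)
      qed
      also have "\<dots> \<in> sets ?R" by (simp add: sets_PiM_I_finite M_def)
      finally show ?thesis .
    next
      case False
      then have "?h -` {l} \<inter> space ?R = {}" by auto
      then show ?thesis by (simp only: sets.empty_sets)
    qed
    have "?h \<in> ?R \<rightarrow>\<^sub>M count_space UNIV"
    proof (rule measurable_count_space_eq2_countable[THEN iffD2])
      show "?h \<in> space ?R \<rightarrow> UNIV \<and> (\<forall>l\<in>UNIV. ?h -` {l} \<inter> space ?R \<in> sets ?R)"
        using atom by blast
    qed
    moreover have "(\<lambda>l. K n (\<lambda>k. l ! k)) \<in> count_space UNIV \<rightarrow>\<^sub>M subprob_algebra (M n)"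
      by (simp add: space_subprob_algebra M_def prob_space_imp_subprob_space probK setsK)
    ultimately have "(\<lambda>\<omega>. K n (\<lambda>k. ?h \<omega> ! k)) \<in> ?R \<rightarrow>\<^sub>M subprob_algebra (M n)"
      by (rule measurable_compose)
    moreover have "(\<lambda>\<omega>. K n (\<lambda>k. ?h \<omega> ! k)) = K n"
      by (rule ext, rule K_cong) simp
    ultimately show ?thesis by (simp only:)
  qed
  interpret IT: Ionescu_Tulcea K M
    by (rule Ionescu_Tulcea.intro) (rule measK, rule probK)
  define P where "P = IT.PF.lim"
  have setsP: "sets P = sets path_space"
    unfolding P_def IT.PF.sets_lim by (simp only: path_space_def M_def)
  have probP: "prob_space P"
  proof (rule prob_spaceI)
    interpret CI: prob_space "IT.CI {}" by (rule IT.PF.prob_space_P) simp_all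
    have "space P = prod_emb UNIV M {} (space (PiM {} M))"
      using sets_eq_imp_space_eq[OF setsP] by (simp add: prod_emb_def spM space_PiM vimage_def restrict_def)
    then have "emeasure P (space P) = emeasure (IT.CI {}) (space (PiM {} M))"
      unfolding P_def by (simp only: IT.lim[OF finite.emptyI sets.top])
    also have "space (PiM {} M) = space (IT.CI {})" by (simp add: IT.CI_def)
    also have "emeasure (IT.CI {}) \<dots> = 1" by (rule CI.emeasure_space_1)
    finally show "emeasure P (space P) = 1" .
  qed
  interpret P: prob_space P by (rule probP)
  have spP: "space P = UNIV" using sets_eq_imp_space_eq[OF setsP] by simp
  have single: "{restrict c {0..<n}} \<in> sets (PiM {0..<n} M)" for c n
  proof -
    have "{restrict c {0..<n}} = (\<Pi>\<^sub>E k\<in>{0..<n}. {c k})"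
    proof -
      have "(\<Pi>\<^sub>E k\<in>{0..<n}. {c k}) = (\<Pi>\<^sub>E k\<in>{0..<n}. {restrict c {0..<n} k})"
        by (rule PiE_cong) simp
      also have "\<dots> = {restrict c {0..<n}}" by (rule PiE_singleton) (rule restrict_extensional)
      finally show ?thesis by (rule sym)
    qed
    then show ?thesis by (simp add: sets_PiM_I_finite M_def)
  qed
  have restrict_eq: "restrict \<omega> {0..<n} = restrict c {0..<n} \<longleftrightarrow> (\<forall>k<n. \<omega> k = c k)"
    for \<omega> c :: path and n
  proof
    assume eq: "restrict \<omega> {0..<n} = restrict c {0..<n}"
    show "\<forall>k<n. \<omega> k = c k"
    proof (intro allI impI)
      fix k assume "k < n"
      then show "\<omega> k = c k" using fun_cong[OF eq, of k] by simp
    qed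
  qed (simp add: restrict_def fun_eq_iff)
  have C0: "(\<lambda>x. undefined) \<in> space (PiM {0..<0} M)" by simp
  have cylP: "emeasure P (cyl n c) = emeasure (IT.C 0 (Suc n) (\<lambda>x. undefined)) {restrict c {0..<Suc n}}" for n c
  proof -
    have "cyl n c = prod_emb UNIV M {0..<Suc n} {restrict c {0..<Suc n}}"
      by (auto simp only: cyl_def prod_emb_def spM vimage_def Int_iff mem_Collect_eq singleton_iff
          restrict_eq less_Suc_eq_le space_PiM PiE_UNIV_domain Pi_UNIV UNIV_I)
    then have "emeasure P (cyl n c) = emeasure (IT.CI {0..<Suc n}) {restrict c {0..<Suc n}}"
      unfolding P_def using single by (simp add: IT.lim del: IT.C.simps)
    also have "\<dots> = emeasure (IT.C 0 (Suc n) (\<lambda>x. undefined)) (prod_emb {0..<Suc n} M {0..<Suc n} {restrict c {0..<Suc n}})"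
      by (rule IT.emeasure_CI) (auto simp: single)
    also have "prod_emb {0..<Suc n} M {0..<Suc n} {restrict c {0..<Suc n}} = {restrict c {0..<Suc n}}"
      by (rule prod_emb_id) (auto simp: spM)
    finally show ?thesis .
  qed
  have CSuc: "emeasure (IT.C 0 (Suc n) (\<lambda>x. undefined)) {restrict c {0..<Suc n}} =
      emeasure (K n c) {c n} * emeasure (IT.C 0 n (\<lambda>x. undefined)) {restrict c {0..<n}}" for n c
  proof -
    let ?C = "IT.C 0 n (\<lambda>x. undefined)"
    have sC: "space ?C = space (PiM {0..<n} M)" "sets ?C = sets (PiM {0..<n} M)"
      using IT.space_C[OF C0, of n] IT.sets_C[OF C0, of n] by auto
    have neC: "space ?C \<noteq> {}" using IT.prob_space_C[OF C0, of n] by (simp add: prob_space.not_empty)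
    have "emeasure (IT.C 0 (Suc n) (\<lambda>x. undefined)) {restrict c {0..<Suc n}}
        = (\<integral>\<^sup>+\<omega>. emeasure (IT.eP n \<omega>) {restrict c {0..<Suc n}} \<partial>?C)"
    proof -
      have "IT.eP n \<in> ?C \<rightarrow>\<^sub>M subprob_algebra (PiM {0..<Suc n} M)"
        unfolding measurable_cong_sets[OF sC(2) refl] by (rule IT.measurable_eP)
      from emeasure_bind[OF neC this single] show ?thesis by simp
    qed
    also have "\<dots> = (\<integral>\<^sup>+\<omega>. emeasure (K n c) {c n} * indicator {restrict c {0..<n}} \<omega> \<partial>?C)"
    proof (rule nn_integral_cong)
      fix \<omega> assume "\<omega> \<in> space ?C"
      then have \<omega>: "\<omega> \<in> space (PiM {0..<n} M)" by (simp add: sC)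
      then have undef: "\<omega> k = undefined" if "k \<ge> n" for k
        using that by (auto simp: space_PiM PiE_iff extensional_def)
      have "emeasure (IT.eP n \<omega>) {restrict c {0..<Suc n}} =
          emeasure (K n \<omega>) ((\<lambda>y. fun_upd \<omega> n y) -` {restrict c {0..<Suc n}} \<inter> space (M n))"
        by (rule IT.emeasure_eP[OF \<omega> single])
      also have "\<dots> = emeasure (K n c) {c n} * indicator {restrict c {0..<n}} \<omega>"
      proof (cases "\<omega> = restrict c {0..<n}")
        case True
        have "fun_upd \<omega> n y = restrict c {0..<Suc n} \<longleftrightarrow> y = c n" for y
        proof
          assume "fun_upd \<omega> n y = restrict c {0..<Suc n}"
          from fun_cong[OF this, of n] show "y = c n" by simp
        qed (simp add: True restrict_def fun_eq_iff less_Suc_eq)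
        then have "(\<lambda>y. fun_upd \<omega> n y) -` {restrict c {0..<Suc n}} \<inter> space (M n) = {c n}"
          by (simp only: spM vimage_def singleton_iff) simp
        moreover have "K n \<omega> = K n c" by (rule K_cong) (simp add: True)
        ultimately show ?thesis using True by simp
      next
        case False
        have "(\<lambda>y. fun_upd \<omega> n y) -` {restrict c {0..<Suc n}} = {}"
        proof (rule ccontr)
          assume "(\<lambda>y. fun_upd \<omega> n y) -` {restrict c {0..<Suc n}} \<noteq> {}"
          then obtain y where y: "fun_upd \<omega> n y = restrict c {0..<Suc n}" by auto
          have "\<omega> k = restrict c {0..<n} k" for k
          proof (cases "k < n")
            case True
            then show ?thesis using fun_cong[OF y, of k] by simp
          qed (simp add: undef)
          then have "\<omega> = restrict c {0..<n}" by (rule ext)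
          with False show False by contradiction
        qed
        then show ?thesis using False by simp
      qed
      finally show "emeasure (IT.eP n \<omega>) {restrict c {0..<Suc n}} =
        emeasure (K n c) {c n} * indicator {restrict c {0..<n}} \<omega>" .
    qed
    also have "\<dots> = emeasure (K n c) {c n} * emeasure ?C {restrict c {0..<n}}"
      using single sC by (simp add: nn_integral_cmult_indicator)
    finally show ?thesis .
  qed
  have K_Suc: "emeasure (K (Suc n) c) {y} = ennreal (step_prob (cookie \<beta> n c) (y - c n))" for n c y
    by (simp add: K_def point_measure_def emeasure_density nn_integral_indicator_singleton)
  have step: "measure P (cyl (Suc n) c) =
      step_prob (cookie \<beta> n c) (c (Suc n) - c n) * measure P (cyl n c)" for n c
  proof -
    have "emeasure P (cyl (Suc n) c) = ennreal (step_prob (cookie \<beta> n c) (c (Suc n) - c n)) * emeasure P (cyl n c)"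
      using CSuc[of "Suc n" c] unfolding cylP K_Suc .
    then show ?thesis
      using step_prob_bounds[OF env, of n c "c (Suc n) - c n"]
      by (simp add: P.emeasure_eq_measure flip: ennreal_mult)
  qed
  have "emeasure P (cyl 0 (\<lambda>_. x)) = 1"
    unfolding cylP CSuc[of 0] by (simp add: K_def C0 restrict_def sets_PiM_empty)
  then have "AE \<omega> in P. \<omega> \<in> cyl 0 (\<lambda>_. x)"
    using P.prob_eq_1[of "cyl 0 (\<lambda>_. x)"] by (simp add: setsP cyl_sets P.emeasure_eq_measure)
  then have init: "AE \<omega> in P. \<omega> 0 = x" by (simp add: cyl_def)
  show ?thesis
    using is_walk_lawI[OF env probP setsP init step] by blast
qed

theorem is_walk_law_walk_law:
  assumes "cookie_env \<beta>"
  shows "is_walk_law \<beta> x (walk_law \<beta> x)"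
  unfolding walk_law_def using walk_law_exists[OF assms] walk_law_unique[OF assms] by (metis theI)

end

theory Submission
  imports Defs
begin

text \<open>Let \<open>G\<close> be the Green function of the simple random walk \<open>p\<close> up to time \<open>n\<close>, so that \<open>G(0)\<close> is at
  least of order \<open>log n\<close> and the total mass of \<open>G\<close> is \<open>n\<close>. Give the walk a nonnegative weight
  \<open>r\<^sub>j\<close> at time \<open>j\<close> and follow \<open>\<Phi>\<^sub>k = \<Sum>\<^bsub>j<k\<^esub> r\<^sub>j G(S\<^sub>k - S\<^sub>j)\<close>. If no site carries more than the weight
  \<open>W\<close>, then \<open>\<Phi>\<^sub>n \<le> W n\<close>, while the mean increment at time \<open>k\<close> is at least
  \<open>r\<^sub>k G(0) - W + b\<^sub>k \<Sum>\<^bsub>j<k\<^esub> r\<^sub>j K(S\<^sub>k - S\<^sub>j)\<close>, where \<open>K\<close> is half the difference of the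
  horizontal and the vertical average of \<open>G\<close>.

  In the coordinates \<open>u = x + y\<close>, \<open>v = x - y\<close> the walk splits into two independent one-dimensional walks and
  \<open>K = \<Sum>\<^sub>k \<delta>q\<^sub>k(u) \<delta>q\<^sub>k(v) / 4\<close>. So \<open>K\<close> has the sign of \<open>u v\<close>, and telescoping shows that its positive
  and negative parts have mass at most exactly \<open>G(0)\<close>: a drift interacting with weights \<open>\<le> W\<close> costs at most
  \<open>W G(0) |b\<^sub>k|\<close>. On the other hand convolution with \<open>K\<close> is bounded on \<open>\<ell>\<^sup>2\<close>, so the symmetric interaction of
  cookies of equal sign costs only \<open>O(W n)\<close>.

  With \<open>r = b\<^sub>+\<close>, \<open>r = b\<^sub>-\<close> and \<open>r = \<close> indicator of a new site this gives, for the expectations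
  \<open>X\<close>, \<open>Y\<close> of the positive and negative drift and \<open>R\<close> of the range, and with \<open>c = O(n / G(0))\<close>,
  \<open>X \<le> A (c + Y)\<close>, \<open>Y \<le> B (c + X)\<close> and \<open>R \<le> c + X + Y\<close>, which can be solved since \<open>A B < 1\<close>.\<close>

section \<open>The Green function of the simple random walk\<close>

fun srw :: "nat \<Rightarrow> int \<Rightarrow> real"
  where
    "srw 0 u = of_bool (u = 0)"
  | "srw (Suc k) u = (srw k (u - 1) + srw k (u + 1)) / 2"

definition srw_diff :: "nat \<Rightarrow> int \<Rightarrow> real"
  where "srw_diff k u = srw k (u - 1) - srw k (u + 1)"

lemma srw_nonneg: "0 \<le> srw k u"
  by (induction k arbitrary: u) auto

lemma srw_minus: "srw k (- u) = srw k u"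
proof (induction k arbitrary: u)
  case (Suc k)
  have "srw k (- u - 1) = srw k (u + 1)" "srw k (- u + 1) = srw k (u - 1)"
    using Suc[of "u + 1"] Suc[of "u - 1"] by (simp_all add: minus_diff_commute add.commute)
  then show ?case by simp
qed simp

lemma srw_diff_minus: "srw_diff k (- u) = - srw_diff k u"
  using srw_minus[of k "u + 1"] srw_minus[of k "u - 1"]
  by (simp add: srw_diff_def minus_diff_commute add.commute)

lemma srw_diff_0 [simp]: "srw_diff k 0 = 0"
  using srw_diff_minus[of k 0] by simp

text \<open>Differencing commutes with averaging: the value at level \<open>Suc k\<close> is the
  mean of the values at \<open>u - 1\<close> and \<open>u + 1\<close>, both at nonnegative arguments
  unless \<open>u = 0\<close>, where oddness gives zero. Hence \<open>srw k\<close> is unimodal on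
  each parity class.\<close>

lemma srw_diff_nonneg: "0 \<le> u \<Longrightarrow> 0 \<le> srw_diff k u"
proof (induction k arbitrary: u)
  case (Suc k)
  show ?case
  proof (cases "u = 0")
    case False
    then have "0 \<le> srw_diff k (u - 1)" "0 \<le> srw_diff k (u + 1)"
      using Suc.prems by (auto intro: Suc.IH)
    then show ?thesis by (simp add: srw_diff_def field_simps)
  qed simp
qed (simp add: srw_diff_def)

lemma srw_diff_nonpos: "u \<le> 0 \<Longrightarrow> srw_diff k u \<le> 0"
  using srw_diff_nonneg[of "- u" k] by (simp add: srw_diff_minus)

text \<open>The total mass is expressed through arbitrary finite sets, so that no question of
  summability arises; the later mass bounds follow the same pattern.\<close>

lemma sum_srw_le_1: "finite U \<Longrightarrow> (\<Sum>u\<in>U. srw k u) \<le> 1"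
proof (induction k arbitrary: U)
  case (Suc k)
  have "(\<Sum>u\<in>U. srw (Suc k) u) = ((\<Sum>u\<in>(\<lambda>u. u - 1) ` U. srw k u) + (\<Sum>u\<in>(\<lambda>u. u + 1) ` U. srw k u)) / 2"
    by (simp add: sum.reindex sum.distrib add_divide_distrib sum_divide_distrib)
  also have "\<dots> \<le> 1"
    using Suc.IH[of "(\<lambda>u. u - 1) ` U"] Suc.IH[of "(\<lambda>u. u + 1) ` U"] Suc.prems by simp
  finally show ?case .
next
  case 0
  then have "(\<Sum>u\<in>U. srw 0 u) = (\<Sum>u\<in>U \<inter> {0}. 1)"
    by (intro sum.mono_neutral_cong_right) auto
  also have "\<dots> \<le> (\<Sum>u\<in>{0::int}. 1)" by (intro sum_mono2) auto
  finally show ?case by simp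
qed

text \<open>Steps of size two make the differences telescope, here from \<open>srw k 0\<close> and
  for even arguments from \<open>srw k 1\<close>. The parities are kept apart because
  \<open>x + y\<close> and \<open>x - y\<close> always have the same parity.\<close>

lemma sum_srw_diff_odd: "(\<Sum>i<m. srw_diff k (2 * int i + 1)) \<le> srw k 0"
proof -
  have "(\<Sum>i<m. srw_diff k (2 * int i + 1)) = srw k 0 - srw k (2 * int m)"
    by (induction m) (simp_all add: srw_diff_def algebra_simps)
  then show ?thesis using srw_nonneg[of k "2 * int m"] by simp
qed

lemma sum_srw_diff_even: "(\<Sum>i<m. srw_diff k (2 * int i + 2)) \<le> srw k 1"
proof -
  have "(\<Sum>i<m. srw_diff k (2 * int i + 2)) = srw k 1 - srw k (2 * int m + 1)"
    by (induction m) (simp_all add: srw_diff_def algebra_simps)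
  then show ?thesis using srw_nonneg[of k "2 * int m + 1"] by simp
qed

lemma srw_1: "srw k 1 = srw (Suc k) 0"
  using srw_minus[of k 1] by simp

section \<open>Lower bound on the return probabilities\<close>

lemma srw_binomial: "srw k (2 * int j - int k) = real (k choose j) / 2 ^ k"
proof (induction k arbitrary: j)
  case 0
  then show ?case by (cases j) auto
next
  case (Suc k)
  \<comment> \<open>The index \<open>j\<close>, a natural number, counts upward steps and cannot
    describe positions below \<open>- k\<close>. Pascal's rule needs one such value when
    \<open>j = 0\<close>.\<close>
  have neg: "srw k u = 0" if "u < - int k" for u
    using that by (induction k arbitrary: u) auto
  show ?case
  proof (cases j)
    case 0
    then show ?thesis using Suc[of 0] neg[of "- int k - 2"] by (simp add: field_simps algebra_simps)
  next
    case (Suc i)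
    have "2 * int j - int (Suc k) - 1 = 2 * int i - int k" "2 * int j - int (Suc k) + 1 = 2 * int j - int k"
      using Suc by simp_all
    then have "srw (Suc k) (2 * int j - int (Suc k)) = (real (k choose i) / 2 ^ k + real (k choose j) / 2 ^ k) / 2"
      by (simp only: srw.simps Suc.IH)
    then show ?thesis by (simp add: Suc field_simps)
  qed
qed

text \<open>Squared form of \<open>(2m choose m) >= 4^m / (2 sqrt m)\<close>. The squared ratio of
  consecutive central binomial coefficients is \<open>4 (2m+1)^2 / (m+1)^2\<close>, and
  \<open>4m(m+1) <= (2m+1)^2\<close> closes the induction.\<close>

lemma central_binomial_square: "m \<ge> 1 \<Longrightarrow> (4::real) ^ (2 * m) \<le> 4 * real m * (real ((2 * m) choose m))\<^sup>2"
proof (induction m rule: dec_induct)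
  case base
  then show ?case by simp
next
  case (step m)
  have "(m + 1) * (2 * Suc m choose Suc m) = (2 * m + 2) * (2 * m + 1 choose m)"
    using Suc_times_binomial_eq[of "2 * m + 1" m] by simp
  also have "\<dots> = 2 * ((2 * m + 1 choose m) * (m + 1))"
    by (simp add: algebra_simps)
  also have "(2 * m + 1 choose m) * (m + 1) = (2 * m + 1) * (2 * m choose m)"
    using Suc_times_binomial_eq[of "2 * m" m] binomial_symmetric[of m "2 * m + 1"] by simp
  finally have "Suc m * (2 * Suc m choose Suc m) = 2 * (2 * m + 1) * (2 * m choose m)"
    by simp
  then have "real (Suc m * (2 * Suc m choose Suc m)) = real (2 * (2 * m + 1) * (2 * m choose m))"
    by (rule arg_cong)
  then have "real (Suc m) * real (2 * Suc m choose Suc m) = 2 * (2 * real m + 1) * real ((2 * m) choose m)"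
    unfolding of_nat_mult of_nat_add by (simp only: of_nat_numeral of_nat_1)
  then have "(real (Suc m) * real (2 * Suc m choose Suc m))\<^sup>2 = (2 * (2 * real m + 1) * real ((2 * m) choose m))\<^sup>2"
    by simp
  then have eq: "(real (Suc m))\<^sup>2 * (real (2 * Suc m choose Suc m))\<^sup>2 = 4 * (2 * real m + 1)\<^sup>2 * (real ((2 * m) choose m))\<^sup>2"
    by (simp only: power_mult_distrib) simp
  have "real m * real (Suc m) * 4 ^ (2 * Suc m) = 16 * real m * real (Suc m) * 4 ^ (2 * m)" by simp
  also have "\<dots> \<le> 16 * real m * real (Suc m) * (4 * real m * (real ((2 * m) choose m))\<^sup>2)"
    using step.IH by (intro mult_left_mono) auto
  also have "\<dots> = 16 * real m * (4 * real m * real (Suc m)) * (real ((2 * m) choose m))\<^sup>2" by simp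
  also have "\<dots> \<le> 16 * real m * (2 * real m + 1)\<^sup>2 * (real ((2 * m) choose m))\<^sup>2"
    by (intro mult_right_mono mult_left_mono) (auto simp: power2_eq_square algebra_simps)
  also have "\<dots> = real m * real (Suc m) * (4 * real (Suc m) * (real (2 * Suc m choose Suc m))\<^sup>2)"
    using arg_cong[OF eq, of "\<lambda>t. 4 * real m * t"]
    by (simp only: power2_eq_square mult_ac)
  finally have "real m * real (Suc m) * 4 ^ (2 * Suc m)
      \<le> real m * real (Suc m) * (4 * real (Suc m) * (real (2 * Suc m choose Suc m))\<^sup>2)" .
  moreover have "0 < real m * real (Suc m)" using step.hyps by simp
  ultimately show ?case by (simp only: mult_le_cancel_left_pos)
qed

lemma srw_0_square_ge: "m \<ge> 1 \<Longrightarrow> 1 / (4 * real m) \<le> (srw (2 * m) 0)\<^sup>2"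
proof -
  assume m: "m \<ge> 1"
  have "srw (2 * m) 0 = real ((2 * m) choose m) / 2 ^ (2 * m)"
    using srw_binomial[of "2 * m" m] by simp
  moreover have "((2::real) ^ (2 * m))\<^sup>2 = 4 ^ (2 * m)"
    by (simp add: power_mult[symmetric] power_mult_distrib[symmetric] power2_eq_square)
  ultimately show "1 / (4 * real m) \<le> (srw (2 * m) 0)\<^sup>2"
    using central_binomial_square[OF m] m
    by (simp only: power_divide) (simp add: field_simps del: srw.simps)
qed

section \<open>The planar walk in rotated coordinates, its Green function and its kernel\<close>

definition srw2 :: "nat \<Rightarrow> site \<Rightarrow> real"
  where "srw2 k z = srw k (fst z + snd z) * srw k (fst z - snd z)"

definition green :: "nat \<Rightarrow> site \<Rightarrow> real"
  where "green n z = (\<Sum>k<n. srw2 k z)"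

text \<open>The kernel \<open>K\<close>; the sign of \<^const>\<open>srw_diff\<close> makes both factors nonnegative for positive arguments.\<close>

definition aniso :: "nat \<Rightarrow> site \<Rightarrow> real"
  where "aniso n z = (\<Sum>k<n. srw_diff k (fst z + snd z) * srw_diff k (fst z - snd z)) / 4"

definition avg :: "(site \<Rightarrow> real) \<Rightarrow> site \<Rightarrow> real"
  where "avg f z = (f (z + (1, 0)) + f (z - (1, 0)) + f (z + (0, 1)) + f (z - (0, 1))) / 4"

text \<open>The coefficient of the cookie: a step from \<open>z\<close> with cookie \<open>b\<close>
  gives \<open>f\<close> the mean \<open>avg f z + b * skew f z\<close>.\<close>

definition skew :: "(site \<Rightarrow> real) \<Rightarrow> site \<Rightarrow> real"
  where "skew f z = (f (z + (1, 0)) + f (z - (1, 0)) - f (z + (0, 1)) - f (z - (0, 1))) / 4"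

lemma srw2_nonneg: "0 \<le> srw2 k z"
  by (simp add: srw2_def srw_nonneg)

lemma srw2_0: "srw2 0 z = of_bool (z = 0)"
  by (cases z) (auto simp: srw2_def zero_prod_def)

lemma green_nonneg: "0 \<le> green n z"
  by (simp add: green_def sum_nonneg srw2_nonneg)

text \<open>Each of the four unit steps corresponds to one choice of signs in the changes of
  \<open>x + y\<close> and \<open>x - y\<close>, so the planar average is a product of two
  one-dimensional ones. This identifies \<open>srw2\<close> as the transition probability of the
  planar walk.\<close>

lemma avg_srw2: "avg (srw2 k) z = srw2 (Suc k) z"
  by (cases z) (simp add: avg_def srw2_def field_simps)

lemma avg_sum: "avg (\<lambda>z. \<Sum>i\<in>I. f i z) z = (\<Sum>i\<in>I. avg (f i) z)"
  unfolding avg_def sum_divide_distrib[symmetric] sum.distrib ..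

lemma skew_sum: "skew (\<lambda>z. \<Sum>i\<in>I. f i z) z = (\<Sum>i\<in>I. skew (f i) z)"
  unfolding skew_def sum_divide_distrib[symmetric] sum.distrib sum_subtractf ..

lemma avg_green: "avg (green n) z = green n z - of_bool (z = 0) + srw2 n z"
proof -
  have "avg (green n) z = (\<Sum>k<n. srw2 (Suc k) z)"
    unfolding green_def[abs_def] avg_sum by (simp add: avg_srw2)
  also have "\<dots> = green (Suc n) z - srw2 0 z"
    unfolding green_def by (subst sum.lessThan_Suc_shift) simp
  finally show ?thesis by (simp add: green_def srw2_0)
qed

text \<open>A horizontal step moves \<open>x + y\<close> and \<open>x - y\<close> in the same
  direction and a vertical step in opposite directions, so the signed sum of four products factors
  into two differences.\<close>

lemma skew_green: "skew (green n) z = aniso n z"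
proof -
  have "skew (srw2 k) z = srw_diff k (fst z + snd z) * srw_diff k (fst z - snd z) / 4" for k
    by (cases z) (simp add: skew_def srw2_def srw_diff_def field_simps)
  then show ?thesis
    unfolding green_def[abs_def] skew_sum aniso_def sum_divide_distrib by (simp only:)
qed

lemma aniso_minus: "aniso n (- z) = aniso n z"
proof -
  have "srw_diff k (- fst z - snd z) = - srw_diff k (fst z + snd z)"
       "srw_diff k (- fst z + snd z) = - srw_diff k (fst z - snd z)" for k
    using srw_diff_minus[of k "fst z + snd z"] srw_diff_minus[of k "fst z - snd z"] by simp_all
  then show ?thesis by (simp add: aniso_def)
qed

lemma aniso_swap: "aniso n (prod.swap z) = - aniso n z"
proof -
  have "srw_diff k (snd z - fst z) = - srw_diff k (fst z - snd z)" for k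
    using srw_diff_minus[of k "fst z - snd z"] by simp
  then show ?thesis by (simp add: aniso_def sum_negf add.commute)
qed

lemma aniso_0 [simp]: "aniso n 0 = 0"
  by (simp add: aniso_def)

section \<open>Mass of the Green function and of the signed kernel; logarithmic growth\<close>

lemma sum_green_le:
  assumes "finite Y"
  shows "(\<Sum>y\<in>Y. green n y) \<le> real n"
proof -
  have "(\<Sum>y\<in>Y. srw2 k y) \<le> 1" for k
  proof -
    define h where "h = (\<lambda>z::site. (fst z + snd z, fst z - snd z))"
    have "inj h" by (auto simp: inj_def h_def)
    then have "(\<Sum>y\<in>Y. srw2 k y) = (\<Sum>(u, v)\<in>h ` Y. srw k u * srw k v)"
      by (simp add: sum.reindex inj_on_subset srw2_def h_def)
    \<comment> \<open>Enlarging the image to a rectangle adds only nonnegative terms and makes the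
      sum factor.\<close>
    also have "\<dots> \<le> (\<Sum>(u, v)\<in>fst ` h ` Y \<times> snd ` h ` Y. srw k u * srw k v)"
      using assms by (intro sum_mono2 subset_fst_snd) (auto simp: srw_nonneg)
    also have "\<dots> = (\<Sum>u\<in>fst ` h ` Y. srw k u) * (\<Sum>v\<in>snd ` h ` Y. srw k v)"
      by (simp add: sum_product sum.cartesian_product)
    also have "\<dots> \<le> 1 * 1"
      using assms by (intro mult_mono sum_srw_le_1) (auto intro: sum_nonneg srw_nonneg)
    finally show ?thesis by simp
  qed
  then have "(\<Sum>k<n. \<Sum>y\<in>Y. srw2 k y) \<le> (\<Sum>k<n. 1)" by (rule sum_mono)
  then show ?thesis unfolding green_def by (subst sum.swap) simp
qed

lemma green_0: "green n 0 = (\<Sum>k<n. (srw k 0)\<^sup>2)"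
  by (simp add: green_def srw2_def power2_eq_square)

text \<open>By \<open>srw_1\<close> this is the sum \<open>green n 0\<close> shifted by one time
  step: it loses the term 1 of time 0 and gains a term of at most 1.\<close>

lemma sum_srw_1_le: "(\<Sum>k<n. (srw k 1)\<^sup>2) \<le> green n 0"
proof -
  have "(\<Sum>k<n. (srw k 1)\<^sup>2) + 1 = green (Suc n) 0"
    unfolding srw_1 green_0 by (subst sum.lessThan_Suc_shift) simp
  also have "\<dots> \<le> green n 0 + 1"
    using sum_srw_le_1[of "{0}" n] srw_nonneg[of n 0] by (simp add: green_0 power_le_one)
  finally show ?thesis by simp
qed

text \<open>The kernel is positive only in the two quadrants where \<open>x + y\<close> and
  \<open>x - y\<close> have the same strict sign, and these contribute equally. Within a quadrant,
  for each time and parity, the double sum is the square of a telescoping sum. With the factor 1/4,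
  two parities and two quadrants add up to \<open>green n 0\<close>.\<close>

lemma sum_aniso_pos_le:
  assumes "finite Y"
  shows "(\<Sum>y\<in>Y. max (aniso n y) 0) \<le> green n 0"
proof -
  let ?Z = "{z :: site. 0 < aniso n z}"
  \<comment> \<open>\<open>M\<close> exceeds the l^1 norm of every site in \<open>Y\<close>, so that
    indices below \<open>M\<close> suffice for the parametrization.\<close>
  define M where "M = Suc (Max (insert 0 ((\<lambda>z. nat (\<bar>fst z\<bar> + \<bar>snd z\<bar>)) ` Y)))"
  have M: "\<bar>x\<bar> + \<bar>y\<bar> < int M" if "(x, y) \<in> Y" for x y
  proof -
    have "nat (\<bar>x\<bar> + \<bar>y\<bar>) \<le> Max (insert 0 ((\<lambda>z. nat (\<bar>fst z\<bar> + \<bar>snd z\<bar>)) ` Y))"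
      using that assms by (intro Max_ge) force+
    then show ?thesis by (simp add: M_def)
  qed
  \<comment> \<open>\<open>f t (i, j)\<close> is the site with \<open>x + y = 2 * i + t\<close> and
    \<open>x - y = 2 * j + t\<close>; \<open>t = 1\<close> gives the positive odd pairs and
    \<open>t = 2\<close> the positive even ones.\<close>
  define f where "f t = (\<lambda>(i, j). (int i + int j + t, int i - int j))" for t
  define B where "B = {..<M} \<times> {..<M}"
  define g where "g t = (\<Sum>z\<in>B. aniso n (f t z))" for t
  have fB: "\<exists>z\<in>B. (x, y) = f t z"
    if "x + y = 2 * i + t" "x - y = 2 * j + t" "0 \<le> i" "0 \<le> j" "\<bar>x\<bar> + \<bar>y\<bar> < int M" "0 \<le> t" for x y t i j
    using that by (intro bexI[of _ "(nat i, nat j)"]) (auto simp: f_def B_def)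
  have sign: "srw_diff k u * srw_diff k v \<le> 0" if "0 \<le> u \<and> v \<le> 0 \<or> u \<le> 0 \<and> 0 \<le> v" for k u v
    using that srw_diff_nonneg srw_diff_nonpos by (auto simp: mult_le_0_iff)
  have quad: "0 < x + y \<and> 0 < x - y \<or> x + y < 0 \<and> x - y < 0" if "0 < aniso n (x, y)" for x y
  proof (rule ccontr)
    assume "\<not> ?thesis"
    then have "srw_diff k (x + y) * srw_diff k (x - y) \<le> 0" for k by (intro sign) linarith
    then have "aniso n (x, y) \<le> 0" by (simp add: aniso_def sum_nonpos)
    with that show False by simp
  qed
  define F where "F = f 1 ` B \<union> f 2 ` B"
  have cover1: "(x, y) \<in> F"
    if "0 < x + y" "0 < x - y" "\<bar>x\<bar> + \<bar>y\<bar> < int M" for x y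
  proof (cases "even (x + y)")
    case True
    then obtain a where a: "x + y = 2 * a" by blast
    have "\<exists>z\<in>B. (x, y) = f 2 z"
      by (rule fB[of x y "a - 1" 2 "a - y - 1"]) (use a that in auto)
    then show ?thesis by (auto simp: F_def)
  next
    case False
    then obtain a where a: "x + y = 2 * a + 1" by (elim oddE)
    have "\<exists>z\<in>B. (x, y) = f 1 z"
      by (rule fB[of x y a 1 "a - y"]) (use a that in auto)
    then show ?thesis by (auto simp: F_def)
  qed
  have cover: "Y \<inter> ?Z \<subseteq> F \<union> uminus ` F"
  proof
    fix z assume z: "z \<in> Y \<inter> ?Z"
    obtain x y where xy: "z = (x, y)" by fastforce
    have b: "\<bar>x\<bar> + \<bar>y\<bar> < int M" using M z xy by auto
    have "0 < x + y \<and> 0 < x - y \<or> x + y < 0 \<and> x - y < 0" using quad z xy by auto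
    then show "z \<in> F \<union> uminus ` F"
    proof
      assume "0 < x + y \<and> 0 < x - y"
      then show ?thesis using cover1[of x y] b xy by auto
    next
      assume "x + y < 0 \<and> x - y < 0"
      then have "(- x, - y) \<in> F" using cover1[of "- x" "- y"] b by auto
      then have "- (- x, - y) \<in> uminus ` F" by (rule imageI)
      then show ?thesis using xy by simp
    qed
  qed
  have pos: "0 \<le> aniso n z" if z: "z \<in> F" for z
  proof -
    have "0 \<le> fst z + snd z \<and> 0 \<le> fst z - snd z" using z by (auto simp: F_def f_def)
    then show ?thesis
      unfolding aniso_def by (intro sum_nonneg divide_nonneg_nonneg mult_nonneg_nonneg srw_diff_nonneg) auto
  qed
  have pos': "0 \<le> aniso n z" if "z \<in> uminus ` F" for z
  proof -
    have "\<exists>y\<in>F. z = - y" using that by (simp only: image_iff)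
    then obtain y where "y \<in> F" "z = - y" by (rule bexE)
    then show ?thesis using pos[of y] by (simp add: aniso_minus)
  qed
  have finB: "finite B" by (simp add: B_def)
  have finF: "finite F" by (simp add: F_def finB)
  have F: "(\<Sum>z\<in>F. aniso n z) \<le> g 1 + g 2"
  proof -
    have "(\<Sum>z\<in>F. aniso n z) \<le> (\<Sum>z\<in>f 1 ` B. aniso n z) + (\<Sum>z\<in>f 2 ` B. aniso n z)"
      using finB pos unfolding F_def by (subst sum_Un) (auto intro!: sum_nonneg)
    also have "\<dots> = g 1 + g 2"
      unfolding g_def by (subst (1 2) sum.reindex) (auto simp: inj_on_def f_def)
    finally show ?thesis .
  qed
  have g: "g t = (\<Sum>k<n. (\<Sum>i<M. srw_diff k (2 * int i + t))\<^sup>2) / 4" for t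
  proof -
    have "g t = (\<Sum>z\<in>B. (\<Sum>k<n. srw_diff k (2 * int (fst z) + t) * srw_diff k (2 * int (snd z) + t)) / 4)"
      unfolding g_def
      by (intro sum.cong refl) (auto simp: aniso_def f_def algebra_simps intro!: sum.cong)
    also have "\<dots> = (\<Sum>k<n. \<Sum>z\<in>B. srw_diff k (2 * int (fst z) + t) * srw_diff k (2 * int (snd z) + t)) / 4"
      unfolding sum_divide_distrib[symmetric] by (subst sum.swap) simp
    also have "\<dots> = (\<Sum>k<n. (\<Sum>i<M. srw_diff k (2 * int i + t))\<^sup>2) / 4"
      by (simp add: B_def power2_eq_square sum_product sum.cartesian_product case_prod_unfold)
    finally show ?thesis .
  qed
  have "g 1 \<le> green n 0 / 4"
    unfolding g green_0
    by (intro divide_right_mono sum_mono power_mono sum_srw_diff_odd) (auto intro!: sum_nonneg srw_diff_nonneg)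
  moreover have "g 2 \<le> (\<Sum>k<n. (srw k 1)\<^sup>2) / 4"
    unfolding g
    by (intro divide_right_mono sum_mono power_mono sum_srw_diff_even) (auto intro!: sum_nonneg srw_diff_nonneg)
  ultimately have g12: "g 1 + g 2 \<le> green n 0 / 2" using sum_srw_1_le[of n] by simp
  have "(\<Sum>y\<in>Y. max (aniso n y) 0) = (\<Sum>y\<in>Y \<inter> ?Z. aniso n y)"
    using assms by (intro sum.mono_neutral_cong_right) auto
  also have "\<dots> \<le> (\<Sum>y\<in>F \<union> uminus ` F. aniso n y)"
    using cover finF pos pos' by (intro sum_mono2) blast+
  also have "\<dots> \<le> (\<Sum>y\<in>F. aniso n y) + (\<Sum>y\<in>uminus ` F. aniso n y)"
    using finF pos by (subst sum_Un) (auto intro!: sum_nonneg)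
  also have "(\<Sum>y\<in>uminus ` F. aniso n y) = (\<Sum>y\<in>F. aniso n y)"
    by (subst sum.reindex) (auto simp: aniso_minus inj_on_def)
  also have "(\<Sum>y\<in>F. aniso n y) + (\<Sum>y\<in>F. aniso n y) \<le> green n 0"
    using F g12 by simp
  finally show ?thesis .
qed

lemma sum_aniso_neg_le:
  assumes "finite Y"
  shows "(\<Sum>y\<in>Y. max (- aniso n y) 0) \<le> green n 0"
proof -
  have "(\<Sum>y\<in>Y. max (- aniso n y) 0) = (\<Sum>y\<in>prod.swap ` Y. max (aniso n y) 0)"
    by (subst sum.reindex) (auto simp: aniso_swap)
  also have "\<dots> \<le> green n 0" by (rule sum_aniso_pos_le) (use assms in simp)
  finally show ?thesis .
qed

text \<open>It is enough to count even times: at time \<open>2 * m\<close> the squared return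
  probability is at least \<open>1 / (4 * m)\<close>, and the harmonic sum grows like the
  logarithm.\<close>

lemma ln_le_green_0:
  assumes "1 \<le> n"
  shows "ln (real n + 2) \<le> 16 * green n 0"
proof -
  have *: "ln (real m + 1) \<le> 4 * (\<Sum>k<2 * m + 1. (srw k 0)\<^sup>2)" for m
  proof (induction m)
    case (Suc m)
    have "ln (real (Suc m) + 1) = ln (real m + 1) + ln (1 + 1 / (real m + 1))"
    proof -
      have "real (Suc m) + 1 = (real m + 1) * (1 + 1 / (real m + 1))" by (simp add: field_simps)
      then show ?thesis by (simp only: ln_mult_pos) (simp add: ln_mult_pos add_pos_nonneg)
    qed
    also have "\<dots> \<le> ln (real m + 1) + 1 / (real m + 1)"
      using ln_add_one_self_le_self[of "1 / (real m + 1)"] by simp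
    also have "1 / (real m + 1) \<le> 4 * (srw (2 * Suc m) 0)\<^sup>2"
      using srw_0_square_ge[of "Suc m"] by (simp add: field_simps del: srw.simps)
    also have "ln (real m + 1) + 4 * (srw (2 * Suc m) 0)\<^sup>2 \<le> 4 * (\<Sum>k<2 * Suc m + 1. (srw k 0)\<^sup>2)"
    proof -
      have "(\<Sum>k<2 * Suc m + 1. (srw k 0)\<^sup>2)
          = (\<Sum>k<2 * m + 1. (srw k 0)\<^sup>2) + (srw (2 * m + 1) 0)\<^sup>2 + (srw (2 * Suc m) 0)\<^sup>2"
        by simp
      then show ?thesis using Suc zero_le_power2[of "srw (2 * m + 1) 0"] by linarith
    qed
    finally show ?case by simp
  qed simp
  \<comment> \<open>\<open>2 * m\<close> is the last even time before \<open>n\<close>, so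
    \<open>n + 2 <= 4 * (m + 1)\<close>. The resulting \<open>ln 4 <= 3\<close> is absorbed because
    time 0 alone gives \<open>green n 0 >= 1\<close>.\<close>
  define m where "m = (n - 1) div 2"
  have m: "2 * m + 1 \<le> n" "n \<le> 2 * m + 2" using assms by (auto simp: m_def)
  have 1: "1 \<le> green n 0"
    using member_le_sum[of 0 "{..<n}" "\<lambda>k. (srw k 0)\<^sup>2"] assms by (simp add: green_0)
  have "real (n + 2) \<le> real (4 * (m + 1))" using m by (intro of_nat_mono) arith
  then have "real n + 2 \<le> 4 * (real m + 1)" by simp
  then have "ln (real n + 2) \<le> ln (4 * (real m + 1))" by (subst ln_le_cancel_iff) auto
  also have "\<dots> = ln 4 + ln (real m + 1)" by (subst ln_mult_pos) auto
  also have "ln (4::real) \<le> 3" using ln_le_minus_one[of "4::real"] by simp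
  also have "3 + ln (real m + 1) \<le> 3 + 4 * (\<Sum>k<2 * m + 1. (srw k 0)\<^sup>2)" using *[of m] by simp
  also have "(\<Sum>k<2 * m + 1. (srw k 0)\<^sup>2) \<le> green n 0"
    unfolding green_0 using m by (intro sum_mono2) auto
  finally show ?thesis using 1 by simp
qed

section \<open>Boundedness of the kernel on square summable functions\<close>

lemma sum_shift:
  fixes f :: "'a::ab_group_add \<Rightarrow> real"
  assumes "finite B" "finite C" "\<And>z. f (z + e) \<noteq> 0 \<Longrightarrow> z \<in> B" "\<And>z. f z \<noteq> 0 \<Longrightarrow> z \<in> C"
  shows "(\<Sum>z\<in>B. f (z + e)) = (\<Sum>z\<in>C. f z)"
proof -
  have "(\<Sum>z\<in>B. f (z + e)) = (\<Sum>z\<in>(\<lambda>z. z + e) ` B. f z)"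
    by (subst sum.reindex) auto
  also have "\<dots> = (\<Sum>z\<in>C. f z)"
  proof (rule sum.mono_neutral_cong)
    show "f z = 0" if "z \<in> C - (\<lambda>z. z + e) ` B" for z
    proof (rule ccontr)
      assume "f z \<noteq> 0"
      then have "z - e \<in> B" by (intro assms(3)) simp
      then have "z \<in> (\<lambda>z. z + e) ` B" by (intro image_eqI[of _ _ "z - e"]) simp_all
      with that show False by simp
    qed
  qed (use assms in auto)
  finally show ?thesis .
qed

text \<open>By convexity of the square the average is controlled by the four translates, and
  translation preserves the l^2 norm.\<close>

lemma sum_avg_square_le:
  assumes "finite B" "finite C" "\<And>z. f z \<noteq> 0 \<Longrightarrow> z \<in> C"
  shows "(\<Sum>z\<in>B. (avg f z)\<^sup>2) \<le> (\<Sum>z\<in>C. (f z)\<^sup>2)"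
proof -
  have shift: "(\<Sum>z\<in>B. (f (z + e))\<^sup>2) \<le> (\<Sum>z\<in>C. (f z)\<^sup>2)" for e
  proof -
    have "(\<Sum>z\<in>B. (f (z + e))\<^sup>2) = (\<Sum>z\<in>(\<lambda>z. z + e) ` B. (f z)\<^sup>2)"
      by (subst sum.reindex) auto
    also have "\<dots> = (\<Sum>z\<in>(\<lambda>z. z + e) ` B \<inter> C. (f z)\<^sup>2)"
      using assms by (intro sum.mono_neutral_right) auto
    also have "\<dots> \<le> (\<Sum>z\<in>C. (f z)\<^sup>2)"
      using assms by (intro sum_mono2) auto
    finally show ?thesis .
  qed
  have "(avg f z)\<^sup>2 \<le> ((f (z + (1, 0)))\<^sup>2 + (f (z - (1, 0)))\<^sup>2 + (f (z + (0, 1)))\<^sup>2 + (f (z - (0, 1)))\<^sup>2) / 4" for z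
  proof -
    have "((a + b + c + d) / 4)\<^sup>2 \<le> (a\<^sup>2 + b\<^sup>2 + c\<^sup>2 + d\<^sup>2) / 4" for a b c d :: real
    proof -
      have "0 \<le> (a - b)\<^sup>2 + (a - c)\<^sup>2 + (a - d)\<^sup>2 + (b - c)\<^sup>2 + (b - d)\<^sup>2 + (c - d)\<^sup>2" by simp
      then show ?thesis by (simp add: power2_eq_square field_simps)
    qed
    then show ?thesis unfolding avg_def .
  qed
  then have "(\<Sum>z\<in>B. (avg f z)\<^sup>2) \<le> (\<Sum>z\<in>B. ((f (z + (1, 0)))\<^sup>2 + (f (z - (1, 0)))\<^sup>2 + (f (z + (0, 1)))\<^sup>2 + (f (z - (0, 1)))\<^sup>2) / 4)"
    by (rule sum_mono)
  also have "\<dots> \<le> (\<Sum>z\<in>C. (f z)\<^sup>2)"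
    unfolding sum_divide_distrib[symmetric] sum.distrib
    using shift[of "(1, 0)"] shift[of "- (1, 0)"] shift[of "(0, 1)"] shift[of "- (0, 1)"]
    unfolding add_uminus_conv_diff by argo
  finally show ?thesis .
qed

text \<open>Summation by parts turns the form into the sum of squares of the mixed first difference
  of \<open>u\<close>. This is verified by expanding both expressions into autocorrelations
  \<open>A e\<close> and comparing coefficients.\<close>

lemma sum_mixed_differences:
  fixes u :: "site \<Rightarrow> real"
  assumes C: "finite C" "\<And>z. u z \<noteq> 0 \<Longrightarrow> z \<in> C"
    and B: "finite B" "\<And>z e. u (z + e) \<noteq> 0 \<Longrightarrow> e \<in> {-1..1} \<times> {-1..1} \<Longrightarrow> z \<in> B"
  shows "0 \<le> (\<Sum>z\<in>B. (u (z + (1, 0)) + u (z + (- 1, 0)) - 2 * u (z + 0)) *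
                       (u (z + (0, 1)) + u (z + (0, - 1)) - 2 * u (z + 0)))"
proof -
  define A where "A e = (\<Sum>z\<in>C. u z * u (z + e))" for e
  have A: "(\<Sum>z\<in>B. u (z + e) * u (z + e')) = A (e' - e)" if "e \<in> {-1..1} \<times> {-1..1}" for e e'
  proof -
    have "(\<Sum>z\<in>B. u (z + e) * u (z + e + (e' - e))) = (\<Sum>z\<in>C. u z * u (z + (e' - e)))"
    proof (rule sum_shift[where f = "\<lambda>z. u z * u (z + (e' - e))"])
      fix z assume "u (z + e) * u (z + e + (e' - e)) \<noteq> 0"
      then have "u (z + e) \<noteq> 0" by simp
      then show "z \<in> B" using that by (rule B(2))
    next
      fix z assume "u z * u (z + (e' - e)) \<noteq> 0"
      then show "z \<in> C" by (intro C(2)) simp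
    qed (fact C B)+
    then show ?thesis by (simp add: A_def add.assoc)
  qed
  have A_minus: "A (- e) = A e" if "e \<in> {-1..1} \<times> {-1..1}" for e
  proof -
    have "(\<Sum>z\<in>B. u (z + 0) * u (z + e)) = A (e - 0)" by (rule A) (simp add: zero_prod_def)
    moreover have "(\<Sum>z\<in>B. u (z + e) * u (z + 0)) = A (0 - e)" by (rule A) fact
    ultimately show ?thesis by (simp add: mult.commute)
  qed
  let ?v = "\<lambda>z a b. u (z + (a, b))"
  have A_neg: "A (- 1, 0) = A (1, 0)" "A (0, - 1) = A (0, 1)" "A (- 1, - 1) = A (1, 1)" "A (- 1, 1) = A (1, - 1)"
    using A_minus[of "(1, 0)"] A_minus[of "(0, 1)"] A_minus[of "(1, 1)"] A_minus[of "(1, - 1)"] by simp_all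
  have v: "(\<Sum>z\<in>B. ?v z a b * ?v z c d) = A (c - a, d - b)" if "\<bar>a\<bar> \<le> 1" "\<bar>b\<bar> \<le> 1" for a b c d
    using A[of "(a, b)" "(c, d)"] that by (auto simp: abs_le_iff)
  have "(?v z 1 0 + ?v z (- 1) 0 - 2 * ?v z 0 0) * (?v z 0 1 + ?v z 0 (- 1) - 2 * ?v z 0 0)
      = ?v z 1 0 * ?v z 0 1 + ?v z 1 0 * ?v z 0 (- 1) + ?v z (- 1) 0 * ?v z 0 1 + ?v z (- 1) 0 * ?v z 0 (- 1)
        - 2 * (?v z 1 0 * ?v z 0 0) - 2 * (?v z (- 1) 0 * ?v z 0 0) - 2 * (?v z 0 1 * ?v z 0 0)
        - 2 * (?v z 0 (- 1) * ?v z 0 0) + 4 * (?v z 0 0 * ?v z 0 0)" for z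
    by algebra
  then have "(\<Sum>z\<in>B. (?v z 1 0 + ?v z (- 1) 0 - 2 * ?v z 0 0) * (?v z 0 1 + ?v z 0 (- 1) - 2 * ?v z 0 0))
      = 2 * A (1, 1) + 2 * A (1, - 1) - 4 * A (1, 0) - 4 * A (0, 1) + 4 * A (0, 0)"
    by (simp add: sum.distrib sum_subtractf sum_distrib_left[symmetric] v A_neg)
  also have "\<dots> = (\<Sum>z\<in>B. (?v z 1 1 - ?v z 1 0 - ?v z 0 1 + ?v z 0 0)\<^sup>2)"
  proof -
    have "(?v z 1 1 - ?v z 1 0 - ?v z 0 1 + ?v z 0 0)\<^sup>2
      = ?v z 1 1 * ?v z 1 1 + ?v z 1 0 * ?v z 1 0 + ?v z 0 1 * ?v z 0 1 + ?v z 0 0 * ?v z 0 0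
        - 2 * (?v z 1 1 * ?v z 1 0) - 2 * (?v z 1 1 * ?v z 0 1) + 2 * (?v z 1 1 * ?v z 0 0)
        + 2 * (?v z 1 0 * ?v z 0 1) - 2 * (?v z 1 0 * ?v z 0 0) - 2 * (?v z 0 1 * ?v z 0 0)" for z
      by algebra
    then show ?thesis
      by (simp add: sum.distrib sum_subtractf sum_distrib_left[symmetric] v A_neg)
  qed
  finally show ?thesis by (simp add: sum_nonneg zero_prod_def)
qed

lemma finite_support_avg:
  assumes "finite {z. f z \<noteq> 0}"
  shows "finite {z. avg f z \<noteq> 0}"
proof -
  let ?S = "{z. f z \<noteq> 0}"
  have "{z. avg f z \<noteq> 0} \<subseteq> (\<Union>e\<in>{(1, 0), - (1, 0), (0, 1), - (0, 1)}. (\<lambda>z. z - e) ` ?S)"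
  proof
    fix z assume "z \<in> {z. avg f z \<noteq> 0}"
    then have "f (z + (1, 0)) \<noteq> 0 \<or> f (z + - (1, 0)) \<noteq> 0 \<or> f (z + (0, 1)) \<noteq> 0 \<or> f (z + - (0, 1)) \<noteq> 0"
      by (simp only: avg_def add_uminus_conv_diff mem_Collect_eq) argo
    then obtain e where "e \<in> {(1, 0), - (1, 0), (0, 1), - (0, 1)}" "z + e \<in> ?S" by blast
    then show "z \<in> (\<Union>e\<in>{(1, 0), - (1, 0), (0, 1), - (0, 1)}. (\<lambda>z. z - e) ` ?S)"
      by (intro UN_I[of e] image_eqI[of _ _ "z + e"]) simp_all
  qed
  then show ?thesis by (rule finite_subset) (use assms in auto)
qed

text \<open>The horizontal and vertical second differences commute and are of the same sign, so
  \<^term>\<open>skew u\<close>, essentially their difference, is dominated in \<open>\<ell>\<^sup>2\<close> by their sum \<^term>\<open>u - avg u\<close>.\<close>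

lemma sum_skew_square_le:
  assumes fin: "finite {z. u z \<noteq> 0}" and "finite D"
  obtains B where "finite B" "D \<subseteq> B" "(\<Sum>z\<in>B. (skew u z)\<^sup>2) \<le> (\<Sum>z\<in>B. (u z - avg u z)\<^sup>2)"
proof -
  let ?S = "{z. u z \<noteq> 0}"
  \<comment> \<open>\<open>B\<close> contains every site whose 3 by 3 neighbourhood meets the
    support, so no translated sum is cut off.\<close>
  define B where "B = D \<union> (\<Union>e\<in>{-1..1} \<times> {-1..1}. (\<lambda>z. z - e) ` ?S)"
  have finB: "finite B" using assms by (auto simp: B_def)
  have B: "z \<in> B" if "u (z + e) \<noteq> 0" "e \<in> {-1..1} \<times> {-1..1}" for z e
    unfolding B_def using that by (intro UnI2 UN_I[of e] image_eqI[of _ _ "z + e"]) auto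
  let ?D1 = "\<lambda>z. u (z + (1, 0)) + u (z + (- 1, 0)) - 2 * u (z + 0)"
  let ?D2 = "\<lambda>z. u (z + (0, 1)) + u (z + (0, - 1)) - 2 * u (z + 0)"
  have "0 \<le> (\<Sum>z\<in>B. ?D1 z * ?D2 z)"
    by (rule sum_mixed_differences[of ?S]) (use fin finB B in auto)
  \<comment> \<open>\<open>u - avg u = - (D1 + D2) / 4\<close> and
    \<open>skew u = (D1 - D2) / 4\<close>, whose squares differ by
    \<open>D1 * D2 / 4\<close>.\<close>
  moreover have "(u z - avg u z)\<^sup>2 = (skew u z)\<^sup>2 + ?D1 z * ?D2 z / 4" for z
  proof -
    have e: "z - (1, 0) = z + (- 1, 0)" "z - (0, 1) = z + (0, - 1)" by (cases z; simp)+
    show ?thesis unfolding avg_def skew_def e by (simp add: power2_eq_square field_simps)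
  qed
  ultimately have "(\<Sum>z\<in>B. (skew u z)\<^sup>2) \<le> (\<Sum>z\<in>B. (u z - avg u z)\<^sup>2)"
    by (simp add: sum.distrib sum_divide_distrib[symmetric])
  then show ?thesis using that[of B] finB by (auto simp: B_def)
qed

text \<open>The difference \<open>u - avg u\<close> telescopes to \<open>h - (avg ^^ n) h\<close>,
  whose l^2 norm is at most twice that of \<open>h\<close> by contraction, whatever \<open>n\<close>
  is. So \<open>skew u\<close> has squared norm at most 4 times that of \<open>h\<close>, and
  \<open>2ab <= a^2 + b^2\<close> gives \<open>(1 + 4) / 2\<close>.\<close>

lemma skew_form_bound:
  fixes h :: "site \<Rightarrow> real" and n :: nat
  assumes fin: "finite {z. h z \<noteq> 0}"
  defines "u \<equiv> \<lambda>z. \<Sum>k<n. (avg ^^ k) h z"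
  shows "\<bar>\<Sum>z | h z \<noteq> 0. h z * skew u z\<bar> \<le> 5 / 2 * (\<Sum>z | h z \<noteq> 0. (h z)\<^sup>2)"
proof -
  let ?S = "{z. h z \<noteq> 0}"
  let ?N = "\<Sum>z\<in>?S. (h z)\<^sup>2"
  have fin_k: "finite {z. (avg ^^ k) h z \<noteq> 0}" for k
    by (induction k) (auto simp: fin intro: finite_support_avg)
  have contr: "(\<Sum>z\<in>B. ((avg ^^ k) h z)\<^sup>2) \<le> ?N" if "finite B" for B k
    using that
  proof (induction k arbitrary: B)
    case 0
    have "(\<Sum>z\<in>B. (h z)\<^sup>2) = (\<Sum>z\<in>B \<inter> ?S. (h z)\<^sup>2)"
      using 0 by (intro sum.mono_neutral_right) auto
    also have "\<dots> \<le> ?N" using fin by (intro sum_mono2) auto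
    finally show ?case by simp
  next
    case (Suc k)
    have "(\<Sum>z\<in>B. ((avg ^^ Suc k) h z)\<^sup>2) \<le> (\<Sum>z | (avg ^^ k) h z \<noteq> 0. ((avg ^^ k) h z)\<^sup>2)"
      using sum_avg_square_le[OF Suc.prems fin_k] by simp
    also have "\<dots> \<le> ?N" using fin_k by (rule Suc.IH)
    finally show ?case .
  qed
  have "{z. u z \<noteq> 0} \<subseteq> (\<Union>k<n. {z. (avg ^^ k) h z \<noteq> 0})"
    unfolding u_def by (blast elim: sum.not_neutral_contains_not_neutral)
  then have "finite {z. u z \<noteq> 0}" by (rule finite_subset) (use fin_k in auto)
  then obtain B where B: "finite B" "?S \<subseteq> B"
    and skew_le: "(\<Sum>z\<in>B. (skew u z)\<^sup>2) \<le> (\<Sum>z\<in>B. (u z - avg u z)\<^sup>2)"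
    using fin by (rule sum_skew_square_le)
  have "u z - avg u z = h z - (avg ^^ n) h z" for z
  proof -
    have "avg u z = (\<Sum>k<n. (avg ^^ Suc k) h z)" unfolding u_def avg_sum by simp
    then have "u z - avg u z = - (\<Sum>k<n. (avg ^^ Suc k) h z - (avg ^^ k) h z)"
      by (simp add: u_def sum_subtractf)
    also have "\<dots> = h z - (avg ^^ n) h z" by (subst sum_lessThan_telescope) simp
    finally show ?thesis .
  qed
  moreover have diff_square_le: "(a - b)\<^sup>2 \<le> 2 * a\<^sup>2 + 2 * b\<^sup>2" for a b :: real
    using zero_le_power2[of "a + b"] by (simp add: power2_eq_square algebra_simps)
  ultimately have "(\<Sum>z\<in>B. (u z - avg u z)\<^sup>2) \<le> (\<Sum>z\<in>B. 2 * ((avg ^^ 0) h z)\<^sup>2 + 2 * ((avg ^^ n) h z)\<^sup>2)"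
    using diff_square_le by (intro sum_mono) simp
  also have "\<dots> \<le> 4 * ?N"
    using contr[OF B(1), of 0] contr[OF B(1), of n] by (simp add: sum.distrib sum_distrib_left[symmetric])
  finally have "(\<Sum>z\<in>B. (skew u z)\<^sup>2) \<le> 4 * ?N" using skew_le by simp
  moreover have "(\<Sum>z\<in>?S. (skew u z)\<^sup>2) \<le> (\<Sum>z\<in>B. (skew u z)\<^sup>2)"
    using B by (intro sum_mono2) auto
  ultimately have skew4: "(\<Sum>z\<in>?S. (skew u z)\<^sup>2) \<le> 4 * ?N" by simp
  have "\<bar>\<Sum>z\<in>?S. h z * skew u z\<bar> \<le> (\<Sum>z\<in>?S. ((h z)\<^sup>2 + (skew u z)\<^sup>2) / 2)"
  proof (rule order_trans[OF sum_abs sum_mono])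
    fix z
    show "\<bar>h z * skew u z\<bar> \<le> ((h z)\<^sup>2 + (skew u z)\<^sup>2) / 2"
      using sum_squares_bound[of "\<bar>h z\<bar>" "\<bar>skew u z\<bar>"] by (simp add: abs_mult)
  qed
  also have "\<dots> \<le> 5 / 2 * ?N"
    using skew4 by (simp add: sum.distrib sum_divide_distrib[symmetric])
  finally show ?thesis .
qed

text \<open>Indices at the same site are merged into the site weight \<open>h\<close>; the
  right-hand side is then 5/2 times the squared l^2 norm of \<open>h\<close>. Summing the iterated
  averages of \<open>h\<close> gives its convolution with \<open>green n\<close>, and
  \<open>skew\<close> turns that kernel into \<open>aniso n\<close>.\<close>

lemma aniso_form_bound:
  fixes x :: "'i \<Rightarrow> site" and r :: "'i \<Rightarrow> real"
  assumes J: "finite J"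
  shows "\<bar>\<Sum>i\<in>J. \<Sum>j\<in>J. r i * r j * aniso n (x i - x j)\<bar>
    \<le> 5 / 2 * (\<Sum>i\<in>J. r i * (\<Sum>j\<in>J. r j * of_bool (x j = x i)))"
proof -
  define h where "h z = (\<Sum>j\<in>J. r j * of_bool (x j = z))" for z
  have S: "{z. h z \<noteq> 0} \<subseteq> x ` J"
    unfolding h_def by (auto elim!: sum.not_neutral_contains_not_neutral split: if_splits intro: rev_image_eqI)
  then have fin: "finite {z. h z \<noteq> 0}" by (rule finite_subset) (use J in simp)
  have iter: "(avg ^^ k) h z = (\<Sum>j\<in>J. r j * srw2 k (z - x j))" for k z
  proof (induction k arbitrary: z)
    case 0
    show ?case by (auto simp: h_def srw2_0 eq_commute[of z] intro!: sum.cong)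
  next
    case (Suc k)
    have shift: "avg (\<lambda>z. r j * srw2 k (z - x j)) z = r j * srw2 (Suc k) (z - x j)" for j
      unfolding avg_srw2[symmetric] by (simp add: avg_def algebra_simps)
    have "(avg ^^ Suc k) h z = avg (\<lambda>z. \<Sum>j\<in>J. r j * srw2 k (z - x j)) z"
      by (simp add: Suc[abs_def])
    also have "\<dots> = (\<Sum>j\<in>J. r j * srw2 (Suc k) (z - x j))"
      unfolding avg_sum shift ..
    finally show ?case .
  qed
  have "(\<lambda>z. \<Sum>k<n. (avg ^^ k) h z) = (\<lambda>z. \<Sum>j\<in>J. r j * green n (z - x j))"
    unfolding iter green_def sum_distrib_left by (subst sum.swap) simp
  moreover have "skew (\<lambda>z. r j * green n (z - x j)) z = r j * aniso n (z - x j)" for j z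
    unfolding skew_green[symmetric] by (simp add: skew_def algebra_simps)
  ultimately have skew: "skew (\<lambda>z. \<Sum>k<n. (avg ^^ k) h z) z = (\<Sum>j\<in>J. r j * aniso n (z - x j))" for z
    by (simp add: skew_sum)
  have pair: "(\<Sum>z | h z \<noteq> 0. h z * g z) = (\<Sum>i\<in>J. r i * g (x i))" for g
  proof -
    have "(\<Sum>z | h z \<noteq> 0. h z * g z) = (\<Sum>z\<in>x ` J. h z * g z)"
      using S J by (intro sum.mono_neutral_left) auto
    also have "\<dots> = (\<Sum>z\<in>x ` J. \<Sum>i\<in>J. of_bool (x i = z) * (r i * g (x i)))"
      unfolding h_def sum_distrib_right by (intro sum.cong) auto
    also have "\<dots> = (\<Sum>i\<in>J. \<Sum>z\<in>x ` J. of_bool (x i = z) * (r i * g (x i)))"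
      by (rule sum.swap)
    also have "\<dots> = (\<Sum>i\<in>J. r i * g (x i))"
      unfolding sum_distrib_right[symmetric] using J by (intro sum.cong) auto
    finally show ?thesis .
  qed
  have "\<bar>\<Sum>i\<in>J. r i * (\<Sum>j\<in>J. r j * aniso n (x i - x j))\<bar> \<le> 5 / 2 * (\<Sum>i\<in>J. r i * h (x i))"
    using skew_form_bound[OF fin, of n] unfolding skew pair power2_eq_square .
  then show ?thesis by (simp add: h_def sum_distrib_left mult.assoc)
qed

section \<open>Drift and range\<close>

definition unit_steps :: "site set"
  where "unit_steps = {(1, 0), - (1, 0), (0, 1), - (0, 1)}"

text \<open>The conditional expectation of \<open>f\<close> given the path up to time \<open>m\<close>, when \<open>f\<close> depends only on
  the path up to time \<open>m + n\<close>. It reads \<open>\<omega>\<close> only up to time \<open>m\<close>.\<close>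

fun walk_exp :: "environment \<Rightarrow> nat \<Rightarrow> nat \<Rightarrow> (path \<Rightarrow> real) \<Rightarrow> path \<Rightarrow> real"
  where
    "walk_exp \<beta> 0 m f \<omega> = f \<omega>"
  | "walk_exp \<beta> (Suc n) m f \<omega> =
      (\<Sum>e\<in>unit_steps. step_prob (cookie \<beta> m \<omega>) e * walk_exp \<beta> n (Suc m) f (fun_upd \<omega> (Suc m) (\<omega> m + e)))"

lemma sum_unit_steps: "sum g unit_steps = g (1, 0) + g (- (1, 0)) + g (0, 1) + g (- (0, 1))"
  for g :: "site \<Rightarrow> 'a::comm_monoid_add"
  by (simp add: unit_steps_def add.assoc)

lemma sum_step_prob_times:
  "(\<Sum>e\<in>unit_steps. step_prob b e * f (z + e)) = avg f z + b * skew f z"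
  unfolding sum_unit_steps avg_def skew_def add_uminus_conv_diff by (simp add: step_prob_def field_simps)

lemma sum_step_prob: "(\<Sum>e\<in>unit_steps. step_prob b e) = 1"
  unfolding sum_unit_steps by (simp add: step_prob_def field_simps)

lemma walk_exp_add: "walk_exp \<beta> n m (\<lambda>\<omega>. f \<omega> + g \<omega>) \<omega> = walk_exp \<beta> n m f \<omega> + walk_exp \<beta> n m g \<omega>"
  by (induction n arbitrary: m \<omega>) (simp_all add: ring_distribs sum.distrib)

lemma walk_exp_cmult: "walk_exp \<beta> n m (\<lambda>\<omega>. a * f \<omega>) \<omega> = a * walk_exp \<beta> n m f \<omega>"
  by (induction n arbitrary: m \<omega>) (simp_all add: sum_distrib_left mult.left_commute)

lemma walk_exp_const: "walk_exp \<beta> n m (\<lambda>_. a) \<omega> = a"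
  by (induction n arbitrary: m \<omega>) (simp_all add: sum_distrib_right[symmetric] sum_step_prob)

lemma walk_exp_mono:
  assumes "cookie_env \<beta>" "\<And>\<omega>. f \<omega> \<le> g \<omega>"
  shows "walk_exp \<beta> n m f \<omega> \<le> walk_exp \<beta> n m g \<omega>"
  using assms
  by (induction n arbitrary: m \<omega>) (auto intro!: sum_mono mult_left_mono step_prob_bounds)

lemma walk_exp_submartingale:
  assumes "cookie_env \<beta>"
    and step: "\<And>k \<omega>. m \<le> k \<Longrightarrow>
      f k \<omega> \<le> (\<Sum>e\<in>unit_steps. step_prob (cookie \<beta> k \<omega>) e * f (Suc k) (fun_upd \<omega> (Suc k) (\<omega> k + e)))"
  shows "f m \<omega> \<le> walk_exp \<beta> n m (f (m + n)) \<omega>"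
  using step
proof (induction n arbitrary: m \<omega>)
  case (Suc n)
  have "f m \<omega> \<le> (\<Sum>e\<in>unit_steps. step_prob (cookie \<beta> m \<omega>) e * f (Suc m) (fun_upd \<omega> (Suc m) (\<omega> m + e)))"
    by (rule Suc.prems) simp
  also have "\<dots> \<le> walk_exp \<beta> (Suc n) m (f (m + Suc n)) \<omega>"
    using Suc.IH[of "Suc m"] Suc.prems
    by (auto intro!: sum_mono mult_left_mono step_prob_bounds[OF assms(1)])
  finally show ?case .
qed simp

section \<open>The potential argument for a general weight\<close>

lemma weighted_sum_le:
  fixes x :: "'i \<Rightarrow> site" and g :: "site \<Rightarrow> real"
  assumes J: "finite J" and r: "\<And>z. (\<Sum>j\<in>J. r j * of_bool (x j = z)) \<le> W" and W: "0 \<le> W"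
    and g: "\<And>y. 0 \<le> g y" "\<And>Y. finite Y \<Longrightarrow> (\<Sum>y\<in>Y. g y) \<le> G"
  shows "(\<Sum>j\<in>J. r j * g (z - x j)) \<le> W * G"
proof -
  \<comment> \<open>Grouping by site produces site weights of at most \<open>W\<close>; the
    displacements \<open>z - y\<close> are then distinct, so the mass bound on \<open>g\<close>
    applies.\<close>
  have "(\<Sum>j\<in>J. r j * g (z - x j)) = (\<Sum>y\<in>x ` J. \<Sum>j\<in>{j \<in> J. x j = y}. r j * g (z - x j))"
    by (rule sum.image_gen[OF J])
  also have "\<dots> = (\<Sum>y\<in>x ` J. (\<Sum>j\<in>J. r j * of_bool (x j = y)) * g (z - y))"
  proof (rule sum.cong[OF refl])
    fix y
    have "(\<Sum>j\<in>{j \<in> J. x j = y}. r j * g (z - x j)) = (\<Sum>j\<in>J. r j * of_bool (x j = y) * g (z - y))"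
      using J by (intro sum.mono_neutral_cong_left) auto
    then show "(\<Sum>j\<in>{j \<in> J. x j = y}. r j * g (z - x j)) = (\<Sum>j\<in>J. r j * of_bool (x j = y)) * g (z - y)"
      by (simp add: sum_distrib_right)
  qed
  also have "\<dots> \<le> (\<Sum>y\<in>x ` J. W * g (z - y))"
    by (intro sum_mono mult_right_mono r g)
  also have "\<dots> = W * (\<Sum>y\<in>(\<lambda>y. z - y) ` x ` J. g y)"
    by (subst sum.reindex) (auto simp: sum_distrib_left inj_on_def)
  also have "\<dots> \<le> W * G"
    using J by (intro mult_left_mono g W) auto
  finally show ?thesis .
qed

text \<open>\<open>\<Psi>\<close> is the potential minus the accumulated lower bounds on its mean
  increments. It vanishes at time \<open>m\<close>, and its conditional mean does not
  decrease.\<close>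

lemma walk_exp_green:
  fixes r :: "nat \<Rightarrow> path \<Rightarrow> real"
  assumes env: "cookie_env \<beta>"
    and nonneg: "\<And>j \<omega>. 0 \<le> r j \<omega>"
    and adapted: "\<And>j k \<omega> y. j \<le> k \<Longrightarrow> r j (fun_upd \<omega> (Suc k) y) = r j \<omega>"
    and W: "\<And>k \<omega> z. (\<Sum>j\<in>{m..<k}. r j \<omega> * of_bool (\<omega> j = z)) \<le> W"
  shows "0 \<le> walk_exp \<beta> n m (\<lambda>\<omega>.
      (\<Sum>j\<in>{m..<m + n}. r j \<omega> * green N (\<omega> (m + n) - \<omega> j)) + W * real n
      - (\<Sum>i\<in>{m..<m + n}. r i \<omega> * green N 0
          + cookie \<beta> i \<omega> * (\<Sum>j\<in>{m..<i}. r j \<omega> * aniso N (\<omega> i - \<omega> j)))) \<omega>"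
proof -
  let ?D = "\<lambda>i \<omega>. \<Sum>j\<in>{m..<i}. r j \<omega> * aniso N (\<omega> i - \<omega> j)"
  let ?S = "\<lambda>k \<omega>. \<Sum>i\<in>{m..<k}. r i \<omega> * green N 0 + cookie \<beta> i \<omega> * ?D i \<omega>"
  define \<Psi> where "\<Psi> k \<omega> = (\<Sum>j\<in>{m..<k}. r j \<omega> * green N (\<omega> k - \<omega> j)) + W * real (k - m) - ?S k \<omega>"
    for k \<omega>
  have lin: "(\<Sum>e\<in>E. p e * ((\<Sum>j\<in>J. a j * G j e) + c))
      = (\<Sum>j\<in>J. a j * (\<Sum>e\<in>E. p e * G j e)) + (\<Sum>e\<in>E. p e) * c"
    for E :: "site set" and J :: "nat set" and p a c and G :: "nat \<Rightarrow> site \<Rightarrow> real"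
    unfolding ring_distribs sum.distrib sum_distrib_left sum_distrib_right
    by (subst sum.swap) (simp add: mult.left_commute)
  have "\<Psi> k \<omega> \<le> (\<Sum>e\<in>unit_steps. step_prob (cookie \<beta> k \<omega>) e * \<Psi> (Suc k) (fun_upd \<omega> (Suc k) (\<omega> k + e)))"
    if k: "m \<le> k" for k \<omega>
  proof -
    let ?b = "cookie \<beta> k \<omega>"
    let ?c = "W * real (Suc k - m) - ?S (Suc k) \<omega>"
    have cookie: "cookie \<beta> i (fun_upd \<omega> (Suc k) y) = cookie \<beta> i \<omega>" if "i \<le> k" for i y
      by (rule cookie_cong) (use that in auto)
    have D: "?D i (fun_upd \<omega> (Suc k) y) = ?D i \<omega>" if "i \<le> k" for i y
      using that by (intro sum.cong refl) (simp add: adapted)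
    have S: "?S (Suc k) (fun_upd \<omega> (Suc k) y) = ?S (Suc k) \<omega>" for y
    proof (intro sum.cong refl)
      fix i assume "i \<in> {m..<Suc k}"
      then have i: "i \<le> k" by simp
      show "r i (fun_upd \<omega> (Suc k) y) * green N 0 + cookie \<beta> i (fun_upd \<omega> (Suc k) y) * ?D i (fun_upd \<omega> (Suc k) y)
          = r i \<omega> * green N 0 + cookie \<beta> i \<omega> * ?D i \<omega>"
        by (simp only: adapted[OF i] cookie[OF i] D[OF i])
    qed
    have upd: "\<Psi> (Suc k) (fun_upd \<omega> (Suc k) (\<omega> k + e)) = (\<Sum>j\<in>{m..<Suc k}. r j \<omega> * green N (\<omega> k - \<omega> j + e)) + ?c" for e
    proof -
      have "(\<Sum>j\<in>{m..<Suc k}. r j (fun_upd \<omega> (Suc k) (\<omega> k + e)) * green N ((fun_upd \<omega> (Suc k) (\<omega> k + e)) (Suc k) - (fun_upd \<omega> (Suc k) (\<omega> k + e)) j))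
          = (\<Sum>j\<in>{m..<Suc k}. r j \<omega> * green N (\<omega> k - \<omega> j + e))"
        by (intro sum.cong refl) (simp add: adapted algebra_simps)
      then show ?thesis unfolding \<Psi>_def S by simp
    qed
    have "(\<Sum>e\<in>unit_steps. step_prob ?b e * \<Psi> (Suc k) (fun_upd \<omega> (Suc k) (\<omega> k + e)))
        = (\<Sum>j\<in>{m..<Suc k}. r j \<omega> * (\<Sum>e\<in>unit_steps. step_prob ?b e * green N (\<omega> k - \<omega> j + e)))
          + (\<Sum>e\<in>unit_steps. step_prob ?b e) * ?c"
      unfolding upd by (rule lin)
    also have "\<dots> = (\<Sum>j\<in>{m..<Suc k}. r j \<omega> * (avg (green N) (\<omega> k - \<omega> j) + ?b * aniso N (\<omega> k - \<omega> j))) + ?c"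
      unfolding sum_step_prob_times sum_step_prob skew_green by simp
    also have "\<dots> \<ge> (\<Sum>j\<in>{m..<Suc k}. r j \<omega> * (green N (\<omega> k - \<omega> j) - of_bool (\<omega> j = \<omega> k) + ?b * aniso N (\<omega> k - \<omega> j))) + ?c"
      using srw2_nonneg[of N] nonneg
      by (intro add_right_mono sum_mono mult_left_mono) (auto simp: avg_green)
    \<comment> \<open>The new term \<open>j = k\<close> contributes
      \<open>r k \<omega> * green N 0\<close>, with no cookie term since
      \<open>aniso N 0 = 0\<close>; the point masses from \<open>avg_green\<close> are
      collected.\<close>
    also have "(\<Sum>j\<in>{m..<Suc k}. r j \<omega> * (green N (\<omega> k - \<omega> j) - of_bool (\<omega> j = \<omega> k) + ?b * aniso N (\<omega> k - \<omega> j)))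
       = (\<Sum>j\<in>{m..<k}. r j \<omega> * green N (\<omega> k - \<omega> j)) + r k \<omega> * green N 0
         - (\<Sum>j\<in>{m..<Suc k}. r j \<omega> * of_bool (\<omega> j = \<omega> k)) + ?b * ?D k \<omega>"
      using k by (simp add: ring_distribs sum.distrib sum_subtractf sum_distrib_left mult.left_commute)
    finally have "(\<Sum>j\<in>{m..<k}. r j \<omega> * green N (\<omega> k - \<omega> j)) + r k \<omega> * green N 0
         - (\<Sum>j\<in>{m..<Suc k}. r j \<omega> * of_bool (\<omega> j = \<omega> k)) + ?b * ?D k \<omega> + ?c
       \<le> (\<Sum>e\<in>unit_steps. step_prob ?b e * \<Psi> (Suc k) (fun_upd \<omega> (Suc k) (\<omega> k + e)))" .
    moreover have "?S (Suc k) \<omega> = ?S k \<omega> + r k \<omega> * green N 0 + ?b * ?D k \<omega>"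
      using k by simp
    moreover have "W * real (Suc k - m) = W * real (k - m) + W"
      using k by (simp add: Suc_diff_le ring_distribs)
    \<comment> \<open>The point masses add up to the weight at the current site, at most
      \<open>W\<close>, which the increment of \<open>W * real (k - m)\<close> pays for.\<close>
    ultimately show ?thesis using W[where k = "Suc k" and z = "\<omega> k" and \<omega> = \<omega>] unfolding \<Psi>_def by argo
  qed
  then have "\<Psi> m \<omega> \<le> walk_exp \<beta> n m (\<Psi> (m + n)) \<omega>"
    by (rule walk_exp_submartingale[OF env])
  then show ?thesis by (simp add: \<Psi>_def[abs_def])
qed

text \<open>At the final time the potential is at most \<open>W * n\<close>, because
  \<open>green n\<close> has mass at most \<open>n\<close>; the compensator adds another
  \<open>W * n\<close>. The function \<open>F\<close> absorbs the cookie interaction.\<close>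

lemma walk_exp_weight_bound:
  fixes r :: "nat \<Rightarrow> path \<Rightarrow> real"
  assumes env: "cookie_env \<beta>"
    and nonneg: "\<And>j \<omega>. 0 \<le> r j \<omega>"
    and adapted: "\<And>j k \<omega> y. j \<le> k \<Longrightarrow> r j (fun_upd \<omega> (Suc k) y) = r j \<omega>"
    and W: "\<And>k \<omega> z. (\<Sum>j\<in>{m..<k}. r j \<omega> * of_bool (\<omega> j = z)) \<le> W" "0 \<le> W"
    and F: "\<And>\<omega>. - (\<Sum>i\<in>{m..<m + n}. cookie \<beta> i \<omega> * (\<Sum>j\<in>{m..<i}. r j \<omega> * aniso n (\<omega> i - \<omega> j))) \<le> F \<omega>"
  shows "green n 0 * walk_exp \<beta> n m (\<lambda>\<omega>. \<Sum>i\<in>{m..<m + n}. r i \<omega>) \<omega>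
    \<le> 2 * W * real n + walk_exp \<beta> n m F \<omega>"
proof -
  have "0 \<le> walk_exp \<beta> n m (\<lambda>\<omega>.
      (\<Sum>j\<in>{m..<m + n}. r j \<omega> * green n (\<omega> (m + n) - \<omega> j)) + W * real n
      - (\<Sum>i\<in>{m..<m + n}. r i \<omega> * green n 0
          + cookie \<beta> i \<omega> * (\<Sum>j\<in>{m..<i}. r j \<omega> * aniso n (\<omega> i - \<omega> j)))) \<omega>"
    by (rule walk_exp_green[OF env nonneg adapted W(1)])
  also have "\<dots> \<le> walk_exp \<beta> n m (\<lambda>\<omega>. 2 * W * real n + (F \<omega> + - green n 0 * (\<Sum>i\<in>{m..<m + n}. r i \<omega>))) \<omega>"
  proof (rule walk_exp_mono[OF env])
    fix \<omega>
    have *: "(\<Sum>j\<in>{m..<m + n}. r j \<omega> * green n (\<omega> (m + n) - \<omega> j)) \<le> W * real n"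
      by (rule weighted_sum_le[OF finite_atLeastLessThan W green_nonneg sum_green_le])
    show "(\<Sum>j\<in>{m..<m + n}. r j \<omega> * green n (\<omega> (m + n) - \<omega> j)) + W * real n
      - (\<Sum>i\<in>{m..<m + n}. r i \<omega> * green n 0
          + cookie \<beta> i \<omega> * (\<Sum>j\<in>{m..<i}. r j \<omega> * aniso n (\<omega> i - \<omega> j)))
      \<le> 2 * W * real n + (F \<omega> + - green n 0 * (\<Sum>i\<in>{m..<m + n}. r i \<omega>))"
    proof -
      have "(\<Sum>i\<in>{m..<m + n}. r i \<omega> * green n 0 + cookie \<beta> i \<omega> * (\<Sum>j\<in>{m..<i}. r j \<omega> * aniso n (\<omega> i - \<omega> j)))
          = green n 0 * (\<Sum>i\<in>{m..<m + n}. r i \<omega>)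
            + (\<Sum>i\<in>{m..<m + n}. cookie \<beta> i \<omega> * (\<Sum>j\<in>{m..<i}. r j \<omega> * aniso n (\<omega> i - \<omega> j)))"
        by (simp add: sum.distrib sum_distrib_left mult.commute[of _ "green n 0"])
      then show ?thesis using F[of \<omega>] * by simp
    qed
  qed
  finally show ?thesis
    by (simp only: walk_exp_add walk_exp_cmult walk_exp_const)
qed

text \<open>An upper bound needs only the positive part of the kernel and a lower bound only the
  negative part, each of mass at most \<open>green n 0\<close>. This keeps the factor at 1, which is
  what lets the system for the two drifts be solved whenever \<open>A * B < 1\<close>.\<close>

lemma abs_weighted_aniso_le:
  assumes "finite J" "\<And>z. (\<Sum>j\<in>J. r j * of_bool (x j = z)) \<le> W" "0 \<le> W" "\<And>j. 0 \<le> r j"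
  shows "\<bar>\<Sum>j\<in>J. r j * aniso n (z - x j)\<bar> \<le> W * green n 0"
proof -
  have "(\<Sum>j\<in>J. r j * aniso n (z - x j)) \<le> (\<Sum>j\<in>J. r j * max (aniso n (z - x j)) 0)"
    by (intro sum_mono mult_left_mono assms) auto
  also have "\<dots> \<le> W * green n 0"
    by (rule weighted_sum_le) (auto intro: assms sum_aniso_pos_le)
  finally have 1: "(\<Sum>j\<in>J. r j * aniso n (z - x j)) \<le> W * green n 0" .
  have "- (\<Sum>j\<in>J. r j * aniso n (z - x j)) = (\<Sum>j\<in>J. r j * - aniso n (z - x j))"
    by (simp add: sum_negf)
  also have "\<dots> \<le> (\<Sum>j\<in>J. r j * max (- aniso n (z - x j)) 0)"
    by (intro sum_mono mult_left_mono assms) auto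
  also have "\<dots> \<le> W * green n 0"
    by (rule weighted_sum_le) (auto intro: assms sum_aniso_neg_le)
  finally show ?thesis using 1 by simp
qed

section \<open>Drift of one sign\<close>

lemma sum_symmetric_square:
  fixes f :: "nat \<Rightarrow> nat \<Rightarrow> real"
  assumes "\<And>i j. f i j = f j i" "\<And>i. f i i = 0"
  shows "(\<Sum>i\<in>{m..<m + n}. \<Sum>j\<in>{m..<m + n}. f i j) = 2 * (\<Sum>i\<in>{m..<m + n}. \<Sum>j\<in>{m..<i}. f i j)"
proof (induction n)
  case (Suc n)
  have "(\<Sum>i\<in>{m..<m + n}. f i (m + n)) = (\<Sum>j\<in>{m..<m + n}. f (m + n) j)"
    by (intro sum.cong refl assms)
  with Suc show ?case by (simp add: sum.distrib assms(2))
qed simp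

text \<open>The local time at \<open>z\<close> strictly increases from visit to visit, so distinct
  visits eat distinct cookies and the sum is part of the series. The sign \<open>s\<close> covers
  positive and negative parts together.\<close>

lemma cookie_weight_le:
  assumes "(\<Sum>j. ennreal (max (s * \<beta> z (Suc j)) 0)) \<le> ennreal W" "0 \<le> W"
  shows "(\<Sum>j\<in>{m..<k}. max (s * cookie \<beta> j \<omega>) 0 * of_bool (\<omega> j = z)) \<le> W"
proof -
  let ?J = "{j \<in> {m..<k}. \<omega> j = z}"
  let ?f = "\<lambda>i. max (s * \<beta> z (Suc i)) 0"
  have less: "local_time i z \<omega> < local_time j z \<omega>" if "i < j" "\<omega> i = z" for i j
  proof -
    have "local_time (Suc i) z \<omega> \<le> local_time j z \<omega>"
      unfolding local_time_def by (rule sum_mono2) (use that in auto)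
    then show ?thesis using that by (simp add: local_time_def)
  qed
  have inj: "inj_on (\<lambda>j. local_time j z \<omega>) ?J"
    by (rule inj_onI) (metis (mono_tags, lifting) less less_irrefl linorder_neqE_nat mem_Collect_eq)
  have "(\<Sum>j\<in>{m..<k}. max (s * cookie \<beta> j \<omega>) 0 * of_bool (\<omega> j = z)) = (\<Sum>j\<in>?J. ?f (local_time j z \<omega>))"
    by (intro sum.mono_neutral_cong_right) (auto simp: cookie_def)
  also have "\<dots> = (\<Sum>i\<in>(\<lambda>j. local_time j z \<omega>) ` ?J. ?f i)"
    using inj by (simp add: sum.reindex)
  finally have eq: "(\<Sum>j\<in>{m..<k}. max (s * cookie \<beta> j \<omega>) 0 * of_bool (\<omega> j = z)) = \<dots>" .
  have "ennreal (\<Sum>i\<in>(\<lambda>j. local_time j z \<omega>) ` ?J. ?f i) = (\<Sum>i\<in>(\<lambda>j. local_time j z \<omega>) ` ?J. ennreal (?f i))"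
    by (rule sum_ennreal[symmetric]) simp
  also have "\<dots> \<le> (\<Sum>i. ennreal (?f i))"
    by (rule sum_le_suminf) auto
  also have "\<dots> \<le> ennreal W" by fact
  finally show ?thesis unfolding eq using assms(2) by (simp only: ennreal_le_iff)
qed

text \<open>The pairs of cookies of the same sign form a symmetric quadratic form, which is bounded without
  a logarithm; only the pairs of opposite signs contribute to the leading order.\<close>

lemma signed_drift_bound:
  assumes env: "cookie_env \<beta>" and s: "s \<in> {1, - 1}"
    and W: "\<And>z. (\<Sum>j. ennreal (max (s * \<beta> z (Suc j)) 0)) \<le> ennreal W" "0 \<le> W"
  shows "green n 0 * walk_exp \<beta> n m (\<lambda>\<omega>. \<Sum>i\<in>{m..<m + n}. max (s * cookie \<beta> i \<omega>) 0) \<omega>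
    \<le> W * (4 * real n + green n 0 * walk_exp \<beta> n m (\<lambda>\<omega>. \<Sum>i\<in>{m..<m + n}. max (- s * cookie \<beta> i \<omega>) 0) \<omega>)"
proof -
  define r where "r j \<omega> = max (s * cookie \<beta> j \<omega>) 0" for j \<omega>
  define q where "q j \<omega> = max (- s * cookie \<beta> j \<omega>) 0" for j \<omega>
  let ?D = "\<lambda>i \<omega>. \<Sum>j\<in>{m..<i}. r j \<omega> * aniso n (\<omega> i - \<omega> j)"
  have r0: "0 \<le> r j \<omega>" and q0: "0 \<le> q j \<omega>" for j \<omega> by (simp_all add: r_def q_def)
  have r1: "r j \<omega> \<le> 1" for j \<omega>
    using cookie_bounds[OF env, of j \<omega>] s by (auto simp: r_def)
  have rW: "(\<Sum>j\<in>{m..<k}. r j \<omega> * of_bool (\<omega> j = z)) \<le> W" for k \<omega> z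
    unfolding r_def by (rule cookie_weight_le[OF W])
  have adapted: "r j (fun_upd \<omega> (Suc k) y) = r j \<omega>" if "j \<le> k" for j k \<omega> y
    unfolding r_def by (subst cookie_cong[of j "fun_upd \<omega> (Suc k) y" \<omega>]) (use that in auto)
  have "green n 0 * walk_exp \<beta> n m (\<lambda>\<omega>. \<Sum>i\<in>{m..<m + n}. r i \<omega>) \<omega>
    \<le> 2 * W * real n + walk_exp \<beta> n m (\<lambda>\<omega>. 2 * W * real n + W * green n 0 * (\<Sum>i\<in>{m..<m + n}. q i \<omega>)) \<omega>"
  proof (rule walk_exp_weight_bound[OF env r0 adapted rW W(2)])
    fix \<omega>
    have cookie: "cookie \<beta> i \<omega> = s * (r i \<omega> - q i \<omega>)" for i
      using s by (auto simp: r_def q_def)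
    \<comment> \<open>The ordered pairs are half of the symmetric form, so the bound is
      \<open>5/4 * W * n\<close>, rounded up to \<open>2 * W * n\<close>.\<close>
    have "\<bar>\<Sum>i\<in>{m..<m + n}. r i \<omega> * ?D i \<omega>\<bar> \<le> 2 * W * real n"
    proof -
      have "2 * (\<Sum>i\<in>{m..<m + n}. r i \<omega> * ?D i \<omega>)
          = (\<Sum>i\<in>{m..<m + n}. \<Sum>j\<in>{m..<m + n}. r i \<omega> * r j \<omega> * aniso n (\<omega> i - \<omega> j))"
      proof -
        have "r i \<omega> * r j \<omega> * aniso n (\<omega> i - \<omega> j) = r j \<omega> * r i \<omega> * aniso n (\<omega> j - \<omega> i)" for i j
          using aniso_minus[of n "\<omega> i - \<omega> j"] by simp
        from sum_symmetric_square[OF this, where m = m and n = n] show ?thesis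
          by (simp add: sum_distrib_left mult.assoc del: sum.op_ivl_Suc)
      qed
      then have "2 * \<bar>\<Sum>i\<in>{m..<m + n}. r i \<omega> * ?D i \<omega>\<bar>
          = \<bar>\<Sum>i\<in>{m..<m + n}. \<Sum>j\<in>{m..<m + n}. r i \<omega> * r j \<omega> * aniso n (\<omega> i - \<omega> j)\<bar>"
        by (simp only: flip: abs_mult_pos'[of 2])
      also have "\<dots> \<le> 5 / 2 * (\<Sum>i\<in>{m..<m + n}. r i \<omega> * (\<Sum>j\<in>{m..<m + n}. r j \<omega> * of_bool (\<omega> j = \<omega> i)))"
        by (rule aniso_form_bound) simp
      also have "\<dots> \<le> 5 / 2 * (\<Sum>i\<in>{m..<m + n}. 1 * W)"
        by (intro mult_left_mono sum_mono mult_mono rW r0 r1 sum_nonneg) (auto simp: r0)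
      also have "\<dots> = 5 / 2 * (W * real n)" by simp
      finally show ?thesis using mult_nonneg_nonneg[OF W(2), of "real n"] by simp
    qed
    then have same: "- s * (\<Sum>i\<in>{m..<m + n}. r i \<omega> * ?D i \<omega>) \<le> 2 * W * real n"
      using s by auto
    have D: "s * ?D i \<omega> \<le> W * green n 0" for i
      using abs_weighted_aniso_le[of "{m..<i}" "\<lambda>j. r j \<omega>" \<omega> W n "\<omega> i"] rW W(2) r0 s by (auto simp: abs_le_iff)
    have "(\<Sum>i\<in>{m..<m + n}. q i \<omega> * (s * ?D i \<omega>)) \<le> (\<Sum>i\<in>{m..<m + n}. q i \<omega> * (W * green n 0))"
      by (intro sum_mono mult_left_mono D q0)
    also have "\<dots> = W * green n 0 * (\<Sum>i\<in>{m..<m + n}. q i \<omega>)"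
      by (simp add: sum_distrib_left mult.commute)
    finally have opposite: "(\<Sum>i\<in>{m..<m + n}. q i \<omega> * (s * ?D i \<omega>)) \<le> W * green n 0 * (\<Sum>i\<in>{m..<m + n}. q i \<omega>)" .
    \<comment> \<open>Since the cookie is \<open>s * (r - q)\<close>, the interaction splits into
      pairs of equal and of opposite sign.\<close>
    have "- (\<Sum>i\<in>{m..<m + n}. cookie \<beta> i \<omega> * ?D i \<omega>)
        = - s * (\<Sum>i\<in>{m..<m + n}. r i \<omega> * ?D i \<omega>) + (\<Sum>i\<in>{m..<m + n}. q i \<omega> * (s * ?D i \<omega>))"
      unfolding cookie sum_distrib_left[of "- s"] sum.distrib[symmetric] sum_negf[symmetric]
      by (intro sum.cong refl) (simp add: algebra_simps)
    then show "- (\<Sum>i\<in>{m..<m + n}. cookie \<beta> i \<omega> * ?D i \<omega>)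
        \<le> 2 * W * real n + W * green n 0 * (\<Sum>i\<in>{m..<m + n}. q i \<omega>)"
      using same opposite by linarith
  qed
  then show ?thesis
    unfolding r_def q_def walk_exp_add walk_exp_cmult walk_exp_const by (simp add: algebra_simps)
qed

section \<open>The range as a sum over first visits\<close>

lemma range_size_eq_sum:
  "real (range_size m n \<omega>) = (\<Sum>j\<in>{m..<m + n}. of_bool (\<forall>i\<in>{m..<j}. \<omega> i \<noteq> \<omega> j))"
proof (induction n)
  case (Suc n)
  have "(\<lambda>j. \<omega> (m + j)) ` {..<Suc n} = insert (\<omega> (m + n)) ((\<lambda>j. \<omega> (m + j)) ` {..<n})"
    by (simp add: lessThan_Suc)
  moreover have "\<omega> (m + n) \<in> (\<lambda>j. \<omega> (m + j)) ` {..<n} \<longleftrightarrow> \<not> (\<forall>i\<in>{m..<m + n}. \<omega> i \<noteq> \<omega> (m + n))"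
  proof -
    have "{m..<m + n} = (\<lambda>j. m + j) ` {..<n}"
      using image_add_atLeastLessThan[of m 0 n] by (simp add: lessThan_atLeast0 add.commute)
    then show ?thesis by (auto simp: eq_commute[of "\<omega> (m + n)"])
  qed
  ultimately show ?case using Suc by (simp add: range_size_def card_insert_if)
qed (simp add: range_size_def)

lemma total_drift_eq_sum: "total_drift \<beta> m n \<omega> = (\<Sum>j\<in>{m..<m + n}. \<bar>cookie \<beta> j \<omega>\<bar>)"
  unfolding total_drift_def by (simp add: sum.atLeastLessThan_shift_0[of _ m] atLeast0LessThan)

text \<open>The weight is the indicator of a first visit since time \<open>m\<close>: a site carries
  weight at most 1, and the total weight is the range. The constant 4 instead of 2 matches the drift
  bounds.\<close>

lemma range_bound:
  assumes env: "cookie_env \<beta>"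
  shows "green n 0 * walk_exp \<beta> n m (\<lambda>\<omega>. real (range_size m n \<omega>)) \<omega>
    \<le> 4 * real n + green n 0 * walk_exp \<beta> n m (total_drift \<beta> m n) \<omega>"
proof -
  define r :: "nat \<Rightarrow> path \<Rightarrow> real"
    where "r j \<omega> = of_bool (\<forall>i\<in>{m..<j}. \<omega> i \<noteq> \<omega> j)" for j \<omega>
  have rW: "(\<Sum>j\<in>{m..<k}. r j \<omega> * of_bool (\<omega> j = z)) \<le> (1::real)" for k \<omega> z
  proof -
    let ?J = "{j \<in> {m..<k}. (\<forall>i\<in>{m..<j}. \<omega> i \<noteq> \<omega> j) \<and> \<omega> j = z}"
    have "(\<Sum>j\<in>{m..<k}. r j \<omega> * of_bool (\<omega> j = z)) = (\<Sum>j\<in>?J. 1::real)"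
      by (intro sum.mono_neutral_cong_right) (auto simp: r_def)
    moreover have "card ?J \<le> 1"
    proof (subst One_nat_def, rule card_le_Suc0_iff_eq[THEN iffD2])
      show "\<forall>i\<in>?J. \<forall>j\<in>?J. i = j"
        by (auto intro!: antisym) (metis atLeastLessThan_iff leI)+
    qed simp
    ultimately show ?thesis by simp
  qed
  have adapted: "r j (fun_upd \<omega> (Suc k) y) = (r j \<omega> :: real)" if "j \<le> k" for j k \<omega> y
    using that by (auto simp: r_def intro!: arg_cong[of _ _ of_bool] ball_cong)
  have "green n 0 * walk_exp \<beta> n m (\<lambda>\<omega>. \<Sum>i\<in>{m..<m + n}. r i \<omega>) \<omega>
    \<le> 2 * 1 * real n + walk_exp \<beta> n m (\<lambda>\<omega>. green n 0 * total_drift \<beta> m n \<omega>) \<omega>"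
  proof (rule walk_exp_weight_bound[OF env _ adapted rW])
    fix \<omega>
    let ?D = "\<lambda>i. \<Sum>j\<in>{m..<i}. r j \<omega> * aniso n (\<omega> i - \<omega> j)"
    have "- (\<Sum>i\<in>{m..<m + n}. cookie \<beta> i \<omega> * ?D i) \<le> (\<Sum>i\<in>{m..<m + n}. \<bar>cookie \<beta> i \<omega> * ?D i\<bar>)"
      using sum_abs[of "\<lambda>i. cookie \<beta> i \<omega> * ?D i" "{m..<m + n}"] by (simp add: abs_le_iff)
    also have "\<dots> \<le> (\<Sum>i\<in>{m..<m + n}. \<bar>cookie \<beta> i \<omega>\<bar> * (1 * green n 0))"
      unfolding abs_mult
      by (intro sum_mono mult_left_mono abs_weighted_aniso_le rW) (auto simp: r_def)
    also have "\<dots> = green n 0 * total_drift \<beta> m n \<omega>"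
      by (simp add: total_drift_eq_sum sum_distrib_left mult.commute)
    finally show "- (\<Sum>i\<in>{m..<m + n}. cookie \<beta> i \<omega> * ?D i) \<le> green n 0 * total_drift \<beta> m n \<omega>" .
  qed (auto simp: r_def)
  then show ?thesis
    unfolding range_size_eq_sum r_def walk_exp_cmult by simp
qed

text \<open>After division by \<open>g\<close>, the three bounds become a linear system in
  \<open>X\<close>, \<open>Y\<close> and \<open>R\<close>. Substituting the first two into each
  other leaves the factor \<open>1 - A * B > 0\<close> on the left.\<close>

lemma walk_exp_total_bound:
  assumes \<beta>: "\<beta> \<in> cookie_envs A B" and A: "0 \<le> A" and B: "0 \<le> B" and AB: "A * B < 1" and n: "1 \<le> n"
  shows "walk_exp \<beta> n m (\<lambda>\<omega>. total_drift \<beta> m n \<omega> + real (range_size m n \<omega>)) \<omega>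
    \<le> 320 * ((1 + A) * (1 + B) / (1 - A * B)) * (real n / ln (real n + 2))"
proof -
  have env: "cookie_env \<beta>" using \<beta> by (simp add: cookie_envs_def)
  have pos: "(\<Sum>j. ennreal (max (1 * \<beta> z (Suc j)) 0)) \<le> ennreal A"
    and neg: "(\<Sum>j. ennreal (max (- 1 * \<beta> z (Suc j)) 0)) \<le> ennreal B" for z
    using \<beta> unfolding cookie_envs_def mult_minus1 mult_1 by blast+
  define g where "g = green n 0"
  define X where "X = walk_exp \<beta> n m (\<lambda>\<omega>. \<Sum>i\<in>{m..<m + n}. max (cookie \<beta> i \<omega>) 0) \<omega>"
  define Y where "Y = walk_exp \<beta> n m (\<lambda>\<omega>. \<Sum>i\<in>{m..<m + n}. max (- cookie \<beta> i \<omega>) 0) \<omega>"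
  define R where "R = walk_exp \<beta> n m (\<lambda>\<omega>. real (range_size m n \<omega>)) \<omega>"
  have ln: "0 < ln (real n + 2)" "ln (real n + 2) \<le> 16 * g"
    using ln_le_green_0[OF n] by (simp_all add: g_def)
  then have g: "0 < g" by linarith
  define c where "c = 4 * real n / g"
  have "\<bar>b\<bar> = max b 0 + max (- b) 0" for b :: real by simp
  then have drift: "walk_exp \<beta> n m (total_drift \<beta> m n) \<omega> = X + Y"
    unfolding X_def Y_def walk_exp_add[symmetric] sum.distrib[symmetric] total_drift_eq_sum[abs_def] by simp
  have "g * X \<le> A * (4 * real n + g * Y)"
    using signed_drift_bound[OF env _ pos A, of n m \<omega>] by (simp add: X_def Y_def g_def)
  also have "\<dots> = g * (A * (c + Y))" using g by (simp add: c_def field_simps)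
  finally have X: "X \<le> A * (c + Y)" using g by simp
  have "g * Y \<le> B * (4 * real n + g * X)"
    using signed_drift_bound[OF env _ neg B, of n m \<omega>] by (simp add: X_def Y_def g_def)
  also have "\<dots> = g * (B * (c + X))" using g by (simp add: c_def field_simps)
  finally have Y: "Y \<le> B * (c + X)" using g by simp
  have "g * R \<le> 4 * real n + g * (X + Y)"
    using range_bound[OF env, of n m \<omega>] unfolding R_def g_def drift .
  also have "\<dots> = g * (c + X + Y)" using g by (simp add: c_def field_simps)
  finally have R: "R \<le> c + X + Y" using g by simp
  define d where "d = 1 - A * B"
  have d: "0 < d" using AB by (simp add: d_def)
  have c0: "0 \<le> c" using g by (simp add: c_def)
  have "X \<le> A * c + A * (B * (c + X))"
    using X mult_left_mono[OF Y A] by (simp add: ring_distribs)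
  then have X': "d * X \<le> c * (A + A * B)" by (simp add: d_def algebra_simps)
  have "Y \<le> B * c + B * (A * (c + Y))"
    using Y mult_left_mono[OF X B] by (simp add: ring_distribs)
  then have Y': "d * Y \<le> c * (B + A * B)" by (simp add: d_def algebra_simps)
  have "d * (X + Y + R) \<le> d * (c + 2 * (X + Y))"
    using R d by (intro mult_left_mono) auto
  also have "\<dots> \<le> d * c + 2 * (c * (A + A * B) + c * (B + A * B))"
  proof -
    have "d * (c + 2 * (X + Y)) = d * c + 2 * (d * X + d * Y)" by (simp add: algebra_simps)
    then show ?thesis using X' Y' by simp
  qed
  also have "\<dots> \<le> 5 * c * ((1 + A) * (1 + B))"
  proof -
    have "0 \<le> c * (4 + 3 * A + 3 * B + 2 * (A * B))"
      using c0 A B by (intro mult_nonneg_nonneg add_nonneg_nonneg) auto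
    then show ?thesis by (simp add: d_def algebra_simps)
  qed
  finally have "X + Y + R \<le> 5 * c * ((1 + A) * (1 + B)) / d"
    using d by (simp add: field_simps)
  also have "\<dots> = 5 * ((1 + A) * (1 + B) / d) * c" by simp
  \<comment> \<open>From \<open>c = 4 * n / g\<close> and \<open>ln (n + 2) <= 16 * g\<close> comes
    the factor 64, and \<open>5 * 64 = 320\<close>.\<close>
  also have "\<dots> \<le> 5 * ((1 + A) * (1 + B) / d) * (64 * (real n / ln (real n + 2)))"
  proof (rule mult_left_mono)
    have "real n / g \<le> real n / (ln (real n + 2) / 16)"
      using ln g by (intro divide_left_mono mult_pos_pos) auto
    then show "c \<le> 64 * (real n / ln (real n + 2))" by (simp add: c_def)
    show "0 \<le> 5 * ((1 + A) * (1 + B) / d)" using A B d by simp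
  qed
  finally show ?thesis
    unfolding walk_exp_add drift R_def[symmetric] by (simp add: d_def)
qed

section \<open>Stopping times\<close>

lemma walk_exp_nonneg:
  assumes "cookie_env \<beta>" "\<And>\<omega>. 0 \<le> f \<omega>"
  shows "0 \<le> walk_exp \<beta> n m f \<omega>"
  using walk_exp_mono[OF assms(1), of "\<lambda>_. 0" f n m \<omega>] assms(2) by (simp add: walk_exp_const)

text \<open>This links \<open>walk_exp\<close> to the walk law, by induction on the remaining number
  of steps: a cylinder splits, up to a null set, into its four one-step extensions, weighted by the
  step probabilities.\<close>

lemma nn_integral_cyl:
  assumes env: "cookie_env \<beta>" and P: "is_walk_law \<beta> x P" and nonneg: "\<And>\<omega>. 0 \<le> f \<omega>"
    and cong: "\<And>\<omega> \<omega>'. (\<And>k. k \<le> m + n \<Longrightarrow> \<omega> k = \<omega>' k) \<Longrightarrow> f \<omega> = f \<omega>'"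
  shows "(\<integral>\<^sup>+\<omega>. ennreal (f \<omega>) * indicator (cyl m c) \<omega> \<partial>P) = ennreal (walk_exp \<beta> n m f c) * emeasure P (cyl m c)"
proof -
  have sets: "sets P = sets path_space" using P by (simp add: is_walk_law_def)
  show ?thesis
    using cong
  proof (induction n arbitrary: m c)
    case 0
    have "(\<integral>\<^sup>+\<omega>. ennreal (f \<omega>) * indicator (cyl m c) \<omega> \<partial>P) = (\<integral>\<^sup>+\<omega>. ennreal (f c) * indicator (cyl m c) \<omega> \<partial>P)"
      by (intro nn_integral_cong) (auto split: split_indicator simp: cyl_def intro!: arg_cong[of _ _ ennreal] 0)
    then show ?case by (simp add: nn_integral_cmult_indicator sets cyl_sets)
  next
    case (Suc n)
    interpret prob_space P using P by (simp add: is_walk_law_def)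
    define c' where "c' e = fun_upd c (Suc m) (c m + e)" for e
    have cyl': "cyl (Suc m) (c' e) = {\<omega> \<in> cyl m c. \<omega> (Suc m) = c m + e}" for e
      by (auto simp: cyl_def c'_def le_Suc_eq)
    have sets_cyl[measurable]: "cyl k a \<in> sets P" for k a by (simp add: sets cyl_sets)
    have meas_f[measurable]: "f \<in> borel_measurable P"
      by (rule measurable_path_by_history[of "m + Suc n"]) (auto intro: Suc.prems simp: sets)
    have step: "measure P (cyl (Suc m) (c' e)) = step_prob (cookie \<beta> m c) e * measure P (cyl m c)" for e
    proof -
      have "cookie \<beta> m (c' e) = cookie \<beta> m c" by (rule cookie_cong) (simp add: c'_def)
      moreover have "cyl m (c' e) = cyl m c" by (auto simp: cyl_def c'_def)
      ultimately show ?thesis using walk_law_cyl_Suc[OF env P, of m "c' e"] by (simp add: c'_def)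
    qed
    have disj: "disjoint_family_on (\<lambda>e. cyl (Suc m) (c' e)) unit_steps"
      by (auto simp: disjoint_family_on_def cyl')
    have fin: "finite unit_steps" by (simp add: unit_steps_def)
    \<comment> \<open>The step probabilities sum to 1, so the four extensions carry the whole mass
      of the cylinder and its other continuations are null.\<close>
    have "measure P (\<Union>e\<in>unit_steps. cyl (Suc m) (c' e)) = (\<Sum>e\<in>unit_steps. measure P (cyl (Suc m) (c' e)))"
      by (rule finite_measure_finite_Union) (use fin disj in auto)
    also have "\<dots> = measure P (cyl m c)"
      unfolding step sum_distrib_right[symmetric] sum_step_prob by simp
    finally have eq: "measure P (\<Union>e\<in>unit_steps. cyl (Suc m) (c' e)) = measure P (cyl m c)" .
    have "(\<Union>e\<in>unit_steps. cyl (Suc m) (c' e)) \<in> sets P" using fin by auto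
    then have "measure P (cyl m c - (\<Union>e\<in>unit_steps. cyl (Suc m) (c' e))) = 0"
      using eq by (subst finite_measure_Diff) (auto simp: cyl')
    then have "AE \<omega> in P. \<omega> \<notin> cyl m c - (\<Union>e\<in>unit_steps. cyl (Suc m) (c' e))"
      using fin by (intro AE_not_in) (auto simp: null_sets_def emeasure_eq_measure)
    then have "AE \<omega> in P. ennreal (f \<omega>) * indicator (cyl m c) \<omega>
        = (\<Sum>e\<in>unit_steps. ennreal (f \<omega>) * indicator (cyl (Suc m) (c' e)) \<omega>)"
    proof eventually_elim
      case (elim \<omega>)
      have "indicator (\<Union>e\<in>unit_steps. cyl (Suc m) (c' e)) \<omega> = (\<Sum>e\<in>unit_steps. indicator (cyl (Suc m) (c' e)) \<omega> :: ennreal)"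
        by (rule indicator_UN_disjoint[OF fin disj])
      moreover have "indicator (cyl m c) \<omega> = (indicator (\<Union>e\<in>unit_steps. cyl (Suc m) (c' e)) \<omega> :: ennreal)"
        using elim by (auto simp: indicator_def cyl')
      ultimately show ?case by (simp add: sum_distrib_left)
    qed
    then have "(\<integral>\<^sup>+\<omega>. ennreal (f \<omega>) * indicator (cyl m c) \<omega> \<partial>P)
        = (\<integral>\<^sup>+\<omega>. (\<Sum>e\<in>unit_steps. ennreal (f \<omega>) * indicator (cyl (Suc m) (c' e)) \<omega>) \<partial>P)"
      by (rule nn_integral_cong_AE)
    also have "\<dots> = (\<Sum>e\<in>unit_steps. \<integral>\<^sup>+\<omega>. ennreal (f \<omega>) * indicator (cyl (Suc m) (c' e)) \<omega> \<partial>P)"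
      by (rule nn_integral_sum) measurable
    also have "\<dots> = (\<Sum>e\<in>unit_steps. ennreal (walk_exp \<beta> n (Suc m) f (c' e)) * emeasure P (cyl (Suc m) (c' e)))"
      by (intro sum.cong refl Suc.IH Suc.prems) simp
    also have "\<dots> = (\<Sum>e\<in>unit_steps. ennreal (step_prob (cookie \<beta> m c) e * walk_exp \<beta> n (Suc m) f (c' e))) * emeasure P (cyl m c)"
      unfolding sum_distrib_right emeasure_eq_measure step
      by (intro sum.cong refl)
         (simp add: ennreal_mult'[symmetric] walk_exp_nonneg[OF env nonneg] step_prob_bounds[OF env] mult_ac)
    also have "(\<Sum>e\<in>unit_steps. ennreal (step_prob (cookie \<beta> m c) e * walk_exp \<beta> n (Suc m) f (c' e)))
        = ennreal (walk_exp \<beta> (Suc n) m f c)"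
      by (subst sum_ennreal) (auto simp: c'_def intro!: mult_nonneg_nonneg walk_exp_nonneg[OF env nonneg] step_prob_bounds[OF env])
    finally show ?case .
  qed
qed

text \<open>An event of the past up to time \<open>m\<close> is a countable disjoint union of
  cylinders, one for each history, and the bound \<open>K\<close> holds on each of them.\<close>

lemma nn_integral_le_by_walk_exp:
  assumes env: "cookie_env \<beta>" and P: "is_walk_law \<beta> x P" and nonneg: "\<And>\<omega>. 0 \<le> f \<omega>"
    and cong: "\<And>\<omega> \<omega>'. (\<And>k. k \<le> m + n \<Longrightarrow> \<omega> k = \<omega>' k) \<Longrightarrow> f \<omega> = f \<omega>'"
    and le: "\<And>c. walk_exp \<beta> n m f c \<le> K"
    and A: "A \<in> sets (walk_filtration (enat m))"
  shows "(\<integral>\<^sup>+\<omega>. ennreal (f \<omega>) * indicator A \<omega> \<partial>P) \<le> ennreal K * emeasure P A"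
proof -
  have sets: "sets P = sets path_space" using P by (simp add: is_walk_law_def)
  obtain L where L: "A = history m -` L" using walk_filtration_history[OF A] .
  define X where "X l = history m -` {l}" for l
  have X_cyl: "X l = {} \<or> (\<exists>c. X l = cyl m c)" for l
    by (auto simp: X_def cyl_def history_eq_iff)
  have X_sets[measurable]: "X l \<in> sets P" for l
    using X_cyl[of l] by (auto simp: sets cyl_sets)
  have f[measurable]: "f \<in> borel_measurable P"
    by (rule measurable_path_by_history[of "m + n"]) (auto intro: cong simp: sets)
  have A_sets[measurable]: "A \<in> sets P" using A sets_walk_filtration_subset sets by blast
  have AX: "A = (\<Union>l\<in>L. X l)" by (auto simp: L X_def)
  have disj: "disjoint_family_on X L" by (auto simp: disjoint_family_on_def X_def)
  have le_X: "emeasure (density P (\<lambda>\<omega>. ennreal (f \<omega>))) (X l) \<le> ennreal K * emeasure P (X l)" for l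
  proof (cases "X l = {}")
    case False
    then obtain c where c: "X l = cyl m c" using X_cyl by blast
    have "emeasure (density P (\<lambda>\<omega>. ennreal (f \<omega>))) (X l) = ennreal (walk_exp \<beta> n m f c) * emeasure P (X l)"
      using nn_integral_cyl[OF env P nonneg cong, where c = c] X_sets[of l] by (simp add: emeasure_density c)
    also have "\<dots> \<le> ennreal K * emeasure P (X l)"
      by (intro mult_right_mono ennreal_leI le) simp
    finally show ?thesis .
  qed simp
  have "(\<integral>\<^sup>+\<omega>. ennreal (f \<omega>) * indicator A \<omega> \<partial>P) = emeasure (density P (\<lambda>\<omega>. ennreal (f \<omega>))) A"
    by (simp add: emeasure_density)
  also have "\<dots> = (\<integral>\<^sup>+l. emeasure (density P (\<lambda>\<omega>. ennreal (f \<omega>))) (X l) \<partial>count_space L)"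
    unfolding AX by (rule emeasure_UN_countable) (auto intro: disj)
  also have "\<dots> \<le> (\<integral>\<^sup>+l. ennreal K * emeasure P (X l) \<partial>count_space L)"
    by (intro nn_integral_mono le_X)
  also have "\<dots> = ennreal K * (\<integral>\<^sup>+l. emeasure P (X l) \<partial>count_space L)"
    by (rule nn_integral_cmult) simp
  also have "(\<integral>\<^sup>+l. emeasure P (X l) \<partial>count_space L) = emeasure P A"
    unfolding AX by (rule emeasure_UN_countable[symmetric]) (auto intro: disj)
  finally show ?thesis .
qed

section \<open>From fixed times to stopping times\<close>

lemma sets_pre_sigma_eq:
  assumes T: "stopping_time walk_filtration T" and A: "A \<in> sets (walk.pre_sigma T)"
  shows "{\<omega> \<in> A. T \<omega> = enat m} \<in> sets (walk_filtration (enat m))"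
proof (cases m)
  case 0
  have "{\<omega> \<in> A. T \<omega> = enat m} = {\<omega> \<in> A. T \<omega> \<le> enat m}"
    using 0 by (auto simp: zero_enat_def[symmetric])
  then show ?thesis using walk.sets_pre_sigmaD[OF T A] by simp
next
  case (Suc k)
  have "{\<omega> \<in> A. T \<omega> = enat m} = {\<omega> \<in> A. T \<omega> \<le> enat m} - {\<omega> \<in> A. T \<omega> \<le> enat k}"
  proof -
    have "t = enat m \<longleftrightarrow> t \<le> enat m \<and> \<not> t \<le> enat k" for t
      by (cases t) (auto simp: Suc)
    then show ?thesis by blast
  qed
  moreover have "{\<omega> \<in> A. T \<omega> \<le> enat k} \<in> sets (walk_filtration (enat m))"
    using walk.sets_pre_sigmaD[OF T A, of "enat k"] walk.sets_F_mono[of "enat k" "enat m"] Suc by auto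
  ultimately show ?thesis using walk.sets_pre_sigmaD[OF T A, of "enat m"] by auto
qed

lemma sets_pre_sigma_subset:
  assumes "stopping_time walk_filtration T"
  shows "sets (walk.pre_sigma T) \<subseteq> sets path_space"
proof
  fix A assume "A \<in> sets (walk.pre_sigma T)"
  from walk.sets_pre_sigmaD[OF assms this, of \<infinity>] show "A \<in> sets path_space"
    by (simp add: sets_walk_filtration_infinity)
qed

text \<open>\<open>T\<close> has countably many values, so its level sets suffice. Where
  \<open>T\<close> is infinite, \<open>the_enat\<close> has an arbitrary value; for an almost surely
  finite \<open>T\<close> this affects only a null set.\<close>

lemma measurable_the_enat_stopping_time:
  assumes T: "stopping_time walk_filtration T" and sets: "sets P = sets path_space"
  shows "(\<lambda>\<omega>. the_enat (T \<omega>)) \<in> P \<rightarrow>\<^sub>M count_space UNIV"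
proof -
  have sp: "space P = UNIV" using sets_eq_imp_space_eq[OF sets] by simp
  have fin: "{\<omega>. T \<omega> = enat m} \<in> sets P" for m
    using sets_pre_sigma_eq[OF T sets.top, of m] sets_walk_filtration_subset sets by (auto simp: walk.space_pre_sigma)
  have inf: "{\<omega>. T \<omega> = \<infinity>} \<in> sets P"
  proof -
    have "{\<omega>. T \<omega> = \<infinity>} = space P - (\<Union>m. {\<omega>. T \<omega> = enat m})"
      using not_infinity_eq by (auto simp: sp)
    then show ?thesis using fin by auto
  qed
  have "T \<in> P \<rightarrow>\<^sub>M count_space UNIV"
  proof (rule measurable_count_space_eq2_countable[THEN iffD2])
    have "T -` {t} \<in> sets P" for t
      using fin inf by (cases t) (auto simp: vimage_def)
    then show "T \<in> space P \<rightarrow> UNIV \<and> (\<forall>t\<in>UNIV. T -` {t} \<inter> space P \<in> sets P)" by (simp add: sp)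
  qed
  then show ?thesis by (rule measurable_compose) simp
qed

text \<open>The bound \<open>K\<close> is uniform in the time and the history, so cutting
  \<open>A\<close> along the values of \<open>T\<close> reduces the claim to fixed times.\<close>

lemma nn_integral_after_stopping_time_le:
  fixes f :: "nat \<Rightarrow> path \<Rightarrow> real"
  assumes env: "cookie_env \<beta>" and P: "is_walk_law \<beta> x P" and nonneg: "\<And>m \<omega>. 0 \<le> f m \<omega>"
    and cong: "\<And>m \<omega> \<omega>'. (\<And>k. k \<le> m + n \<Longrightarrow> \<omega> k = \<omega>' k) \<Longrightarrow> f m \<omega> = f m \<omega>'"
    and le: "\<And>m c. walk_exp \<beta> n m (f m) c \<le> K"
    and T: "stopping_time walk_filtration T" "AE \<omega> in P. T \<omega> < \<infinity>"
    and A: "A \<in> sets (walk.pre_sigma T)"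
  shows "(\<integral>\<^sup>+\<omega>. ennreal (f (the_enat (T \<omega>)) \<omega>) * indicator A \<omega> \<partial>P) \<le> ennreal K * emeasure P A"
proof -
  have sets: "sets P = sets path_space" using P by (simp add: is_walk_law_def)
  have f[measurable]: "f m \<in> borel_measurable P" for m
    by (rule measurable_path_by_history[of "m + n"]) (auto intro: cong simp: sets)
  have [measurable]: "(\<lambda>\<omega>. f (the_enat (T \<omega>)) \<omega>) \<in> borel_measurable P"
    by (rule measurable_compose_countable[OF f measurable_the_enat_stopping_time[OF T(1) sets]])
  have A_sets[measurable]: "A \<in> sets P" using A sets_pre_sigma_subset[OF T(1)] sets by blast
  define X where "X m = {\<omega> \<in> A. T \<omega> = enat m}" for m
  have X: "X m \<in> sets (walk_filtration (enat m))" for m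
    unfolding X_def by (rule sets_pre_sigma_eq[OF T(1) A])
  then have X_sets[measurable]: "X m \<in> sets P" for m
    using sets_walk_filtration_subset sets by blast
  have disj: "disjoint_family_on X UNIV" by (auto simp: disjoint_family_on_def X_def)
  let ?Q = "density P (\<lambda>\<omega>. ennreal (f (the_enat (T \<omega>)) \<omega>))"
  have le_X: "emeasure ?Q (X m) \<le> ennreal K * emeasure P (X m)" for m
  proof -
    have "emeasure ?Q (X m) = (\<integral>\<^sup>+\<omega>. ennreal (f m \<omega>) * indicator (X m) \<omega> \<partial>P)"
      by (simp add: emeasure_density) (auto simp: X_def intro!: nn_integral_cong split: split_indicator)
    also have "\<dots> \<le> ennreal K * emeasure P (X m)"
      by (rule nn_integral_le_by_walk_exp[OF env P nonneg cong le X])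
    finally show ?thesis .
  qed
  have "AE \<omega> in P. ennreal (f (the_enat (T \<omega>)) \<omega>) * indicator A \<omega>
      = ennreal (f (the_enat (T \<omega>)) \<omega>) * indicator (\<Union>m. X m) \<omega>"
    using T(2) by eventually_elim (auto simp: X_def indicator_def)
  then have "(\<integral>\<^sup>+\<omega>. ennreal (f (the_enat (T \<omega>)) \<omega>) * indicator A \<omega> \<partial>P) = emeasure ?Q (\<Union>m. X m)"
    by (simp add: emeasure_density cong: nn_integral_cong_AE)
  also have "\<dots> = (\<integral>\<^sup>+m. emeasure ?Q (X m) \<partial>count_space UNIV)"
    by (rule emeasure_UN_countable) (auto intro: disj)
  also have "\<dots> \<le> (\<integral>\<^sup>+m. ennreal K * emeasure P (X m) \<partial>count_space UNIV)"
    by (intro nn_integral_mono le_X)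
  also have "\<dots> = ennreal K * (\<integral>\<^sup>+m. emeasure P (X m) \<partial>count_space UNIV)"
    by (rule nn_integral_cmult) simp
  also have "(\<integral>\<^sup>+m. emeasure P (X m) \<partial>count_space UNIV) = emeasure P (\<Union>m. X m)"
    by (rule emeasure_UN_countable[symmetric]) (auto intro: disj)
  also have "\<dots> \<le> emeasure P A" by (rule emeasure_mono) (auto simp: X_def)
  finally show ?thesis by (simp add: mult_left_mono)
qed

text \<open>An integrable function with nonnegative integral over every event is almost surely
  nonnegative; this is applied to \<open>K\<close> minus the conditional expectation.\<close>

lemma (in finite_measure_subalgebra) AE_real_cond_exp_le:
  assumes f: "integrable M f" and le: "\<And>A. A \<in> sets F \<Longrightarrow> (\<integral>x\<in>A. f x \<partial>M) \<le> K * measure M A"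
  shows "AE x in M. real_cond_exp M F f x \<le> K"
proof -
  let ?R = "restr_to_subalg M F"
  let ?g = "real_cond_exp M F f"
  interpret R: finite_measure ?R by (rule finite_measure_restr_to_subalg[OF subalg finite_measure_axioms])
  have sets_R: "sets ?R = sets F" by (rule sets_restr_to_subalg[OF subalg])
  have g: "integrable M ?g" using f by (rule real_cond_exp_int)
  have gR: "integrable ?R ?g" by (rule integrable_in_subalg[OF subalg borel_measurable_cond_exp g])
  \<comment> \<open>The integrals are controlled only over events of \<open>F\<close>, so the
    argument runs in the measure restricted to \<open>F\<close>.\<close>
  have "AE x in ?R. 0 \<le> K - ?g x"
  proof (rule R.density_nonneg)
    show "integrable ?R (\<lambda>x. K - ?g x)" using gR by simp
    fix A assume "A \<in> sets ?R"
    then have A: "A \<in> sets F" by (simp add: sets_R)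
    then have AM: "A \<in> sets M" using subalg by (auto simp: subalgebra_def)
    have "(\<integral>x\<in>A. K - ?g x \<partial>?R) = (\<integral>x. indicator A x *\<^sub>R (K - ?g x) \<partial>M)"
      unfolding set_lebesgue_integral_def using A by (intro integral_subalgebra2[OF subalg] borel_measurable_scaleR borel_measurable_indicator
          borel_measurable_diff borel_measurable_const borel_measurable_cond_exp)
    also have "\<dots> = (\<integral>x. K * indicator A x \<partial>M) - (\<integral>x\<in>A. ?g x \<partial>M)"
    proof -
      have "integrable M (\<lambda>x. K * indicator A x)" using AM by (simp add: emeasure_eq_measure)
      moreover have "integrable M (\<lambda>x. indicator A x *\<^sub>R ?g x)" using AM g by (rule integrable_mult_indicator)
      ultimately show ?thesis
        unfolding set_lebesgue_integral_def by (subst Bochner_Integration.integral_diff[symmetric]) (auto simp: algebra_simps)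
    qed
    also have "\<dots> = K * measure M A - (\<integral>x\<in>A. f x \<partial>M)"
      using AM real_cond_exp_intA[OF f A] by simp
    finally show "0 \<le> (\<integral>x\<in>A. K - ?g x \<partial>?R)" using le[OF A] by simp
  qed
  then show ?thesis using AE_restr_to_subalg[OF subalg] by fastforce
qed

section \<open>Boundedness and locality of drift and range, and the final bounds\<close>

lemma total_drift_bounds:
  assumes "cookie_env \<beta>"
  shows "0 \<le> total_drift \<beta> m n \<omega>" "total_drift \<beta> m n \<omega> \<le> real n"
proof -
  show "0 \<le> total_drift \<beta> m n \<omega>" by (simp add: total_drift_def sum_nonneg)
  have "total_drift \<beta> m n \<omega> \<le> (\<Sum>j<n. 1)"
    unfolding total_drift_def using cookie_bounds[OF assms] by (intro sum_mono) (simp add: abs_le_iff minus_le_iff)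
  then show "total_drift \<beta> m n \<omega> \<le> real n" by simp
qed

lemma total_drift_cong:
  assumes "\<And>k. k \<le> m + n \<Longrightarrow> \<omega> k = \<omega>' k"
  shows "total_drift \<beta> m n \<omega> = total_drift \<beta> m n \<omega>'"
  unfolding total_drift_def by (intro sum.cong refl arg_cong[of _ _ abs] cookie_cong assms) simp

lemma range_size_cong:
  assumes "\<And>k. k \<le> m + n \<Longrightarrow> \<omega> k = \<omega>' k"
  shows "range_size m n \<omega> = range_size m n \<omega>'"
  unfolding range_size_def using assms by (intro arg_cong[of _ _ card] image_cong) auto

lemma range_size_le: "range_size m n \<omega> \<le> n"
  unfolding range_size_def using card_image_le[of "{..<n}" "\<lambda>j. \<omega> (m + j)"] by simp

theorem proposition1p3:
  shows "\<exists>C::real. \<forall>A B :: real. 0 \<le> A \<and> 0 \<le> B \<and> A * B < 1 \<longrightarrow> (\<forall>n::nat. 1 \<le> n \<longrightarrow>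
    (let C\<^sub>A\<^sub>B = C * ((1 + A) * (1 + B) / (1 - A * B)) in
      (SUP \<beta>\<in>cookie_envs A B. SUP x.
         ereal ((\<integral>\<omega>. total_drift \<beta> 0 n \<omega> \<partial>walk_law \<beta> x)
              + (\<integral>\<omega>. real (range_size 0 n \<omega>) \<partial>walk_law \<beta> x)))
        \<le> ereal (C\<^sub>A\<^sub>B * (real n / ln (real n + 2))) \<and>
      (\<forall>\<beta>\<in>cookie_envs A B. \<forall>x. \<forall>T.
         stopping_time walk_filtration T \<and> (AE \<omega> in walk_law \<beta> x. T \<omega> < \<infinity>) \<longrightarrow>
         (AE \<omega> in walk_law \<beta> x.
            real_cond_exp (walk_law \<beta> x) (walk.pre_sigma T)
              (\<lambda>\<omega>. total_drift \<beta> (the_enat (T \<omega>)) n \<omega>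
                   + real (range_size (the_enat (T \<omega>)) n \<omega>)) \<omega>
              \<le> C\<^sub>A\<^sub>B * (real n / ln (real n + 2))))))"
proof (rule exI[of _ 320], intro allI impI)
  fix A B :: real and n :: nat
  assume AB: "0 \<le> A \<and> 0 \<le> B \<and> A * B < 1" and n: "1 \<le> n"
  define K where "K = 320 * ((1 + A) * (1 + B) / (1 - A * B)) * (real n / ln (real n + 2))"
  have K: "0 \<le> K" using AB by (simp add: K_def)
  define f where "f \<beta> m \<omega> = total_drift \<beta> m n \<omega> + real (range_size m n \<omega>)" for \<beta> m \<omega>
  have f_cong: "f \<beta> m \<omega> = f \<beta> m \<omega>'" if "\<And>k. k \<le> m + n \<Longrightarrow> \<omega> k = \<omega>' k" for \<beta> m \<omega> \<omega>'
    unfolding f_def using total_drift_cong[of m n \<omega> \<omega>'] range_size_cong[of m n \<omega> \<omega>'] that by simp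
  have f_le: "walk_exp \<beta> n m (f \<beta> m) c \<le> K" if "\<beta> \<in> cookie_envs A B" for \<beta> m c
    unfolding f_def K_def by (rule walk_exp_total_bound) (use that AB n in auto)
  have env: "cookie_env \<beta>" if "\<beta> \<in> cookie_envs A B" for \<beta>
    using that by (simp add: cookie_envs_def)
  have f_nonneg: "0 \<le> f \<beta> m \<omega>" if "cookie_env \<beta>" for \<beta> m \<omega>
    using total_drift_bounds[OF that] by (simp add: f_def)
  \<comment> \<open>This crude pointwise bound provides integrability at the stopping time.\<close>
  have f_le_2n: "f \<beta> m \<omega> \<le> 2 * real n" if "cookie_env \<beta>" for \<beta> m \<omega>
    using total_drift_bounds(2)[OF that, of m n \<omega>] range_size_le[of m n \<omega>] by (simp add: f_def)
  \<comment> \<open>This is the fixed-time bound at time 0, with the whole path space as the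
    event.\<close>
  have expectation: "(\<integral>\<omega>. total_drift \<beta> 0 n \<omega> \<partial>walk_law \<beta> x) + (\<integral>\<omega>. real (range_size 0 n \<omega>) \<partial>walk_law \<beta> x) \<le> K"
    if \<beta>: "\<beta> \<in> cookie_envs A B" for \<beta> x
  proof -
    let ?P = "walk_law \<beta> x"
    have P: "is_walk_law \<beta> x ?P" by (rule is_walk_law_walk_law[OF env[OF \<beta>]])
    interpret prob_space ?P using P by (simp add: is_walk_law_def)
    have sets: "sets ?P = sets path_space" using P by (simp add: is_walk_law_def)
    have "integrable ?P (total_drift \<beta> 0 n)"
    proof (rule integrable_const_bound[of _ "real n"])
      show "AE \<omega> in ?P. norm (total_drift \<beta> 0 n \<omega>) \<le> real n"
        using total_drift_bounds[OF env[OF \<beta>]] by simp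
      show "total_drift \<beta> 0 n \<in> borel_measurable ?P"
        by (rule measurable_path_by_history[of "0 + n"]) (auto intro: total_drift_cong[of 0 n] simp: sets)
    qed
    moreover have "integrable ?P (\<lambda>\<omega>. real (range_size 0 n \<omega>))"
    proof (rule integrable_const_bound[of _ "real n"])
      show "AE \<omega> in ?P. norm (real (range_size 0 n \<omega>)) \<le> real n"
        using range_size_le by simp
      show "(\<lambda>\<omega>. real (range_size 0 n \<omega>)) \<in> borel_measurable ?P"
        by (rule measurable_path_by_history[of "0 + n"]) (auto intro: range_size_cong[of 0 n] simp: sets)
    qed
    ultimately have "(\<integral>\<omega>. total_drift \<beta> 0 n \<omega> \<partial>?P) + (\<integral>\<omega>. real (range_size 0 n \<omega>) \<partial>?P) = (\<integral>\<omega>. f \<beta> 0 \<omega> \<partial>?P)"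
      unfolding f_def by (rule Bochner_Integration.integral_add[symmetric])
    also have "\<dots> \<le> K"
    proof (rule integral_real_bounded[OF K])
      have "(\<integral>\<^sup>+\<omega>. ennreal (f \<beta> 0 \<omega>) * indicator UNIV \<omega> \<partial>?P) \<le> ennreal K * emeasure ?P UNIV"
        using sets.top[of "walk_filtration (enat 0)"] unfolding space_walk_filtration
        by (intro nn_integral_le_by_walk_exp[OF env[OF \<beta>] P f_nonneg[OF env[OF \<beta>]] f_cong f_le[OF \<beta>]]) simp
      also have "\<dots> \<le> ennreal K * 1"
        by (intro mult_left_mono emeasure_le_1) simp
      finally show "(\<integral>\<^sup>+\<omega>. ennreal (f \<beta> 0 \<omega>) \<partial>?P) \<le> ennreal K" by simp
    qed
    finally show ?thesis .
  qed
  have conditional: "AE \<omega> in walk_law \<beta> x. real_cond_exp (walk_law \<beta> x) (walk.pre_sigma T)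
      (\<lambda>\<omega>. f \<beta> (the_enat (T \<omega>)) \<omega>) \<omega> \<le> K"
    if \<beta>: "\<beta> \<in> cookie_envs A B" and T: "stopping_time walk_filtration T" "AE \<omega> in walk_law \<beta> x. T \<omega> < \<infinity>"
    for \<beta> x T
  proof -
    let ?P = "walk_law \<beta> x"
    let ?F = "\<lambda>\<omega>. f \<beta> (the_enat (T \<omega>)) \<omega>"
    note env = env[OF \<beta>]
    have P: "is_walk_law \<beta> x ?P" by (rule is_walk_law_walk_law[OF env])
    interpret prob_space ?P using P by (simp add: is_walk_law_def)
    have sets: "sets ?P = sets path_space" using P by (simp add: is_walk_law_def)
    interpret finite_measure_subalgebra ?P "walk.pre_sigma T"
      using sets_pre_sigma_subset[OF T(1)] sets sets_eq_imp_space_eq[OF sets]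
      by unfold_locales (simp add: subalgebra_def walk.space_pre_sigma)
    have meas: "f \<beta> m \<in> borel_measurable ?P" for m
      by (rule measurable_path_by_history[of "m + n"]) (auto intro: f_cong simp: sets)
    have F: "?F \<in> borel_measurable ?P"
      by (rule measurable_compose_countable[OF meas measurable_the_enat_stopping_time[OF T(1) sets]])
    have int: "integrable ?P ?F"
      by (rule integrable_const_bound[of _ "2 * real n"]) (use F f_nonneg[OF env] f_le_2n[OF env] in auto)
    show ?thesis
    proof (rule AE_real_cond_exp_le[OF int])
      fix D assume D: "D \<in> sets (walk.pre_sigma T)"
      have "(\<integral>\<^sup>+\<omega>. ennreal (indicator D \<omega> *\<^sub>R ?F \<omega>) \<partial>?P) = (\<integral>\<^sup>+\<omega>. ennreal (?F \<omega>) * indicator D \<omega> \<partial>?P)"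
        by (intro nn_integral_cong) (simp split: split_indicator)
      also have "\<dots> \<le> ennreal K * emeasure ?P D"
        by (rule nn_integral_after_stopping_time_le[OF env P f_nonneg[OF env] f_cong f_le[OF \<beta>] T D])
      also have "\<dots> = ennreal (K * measure ?P D)"
        using K by (simp add: emeasure_eq_measure ennreal_mult)
      finally show "(\<integral>\<omega>\<in>D. ?F \<omega> \<partial>?P) \<le> K * measure ?P D"
        unfolding set_lebesgue_integral_def using K by (intro integral_real_bounded) auto
    qed
  qed
  show "let C\<^sub>A\<^sub>B = 320 * ((1 + A) * (1 + B) / (1 - A * B)) in
      (SUP \<beta>\<in>cookie_envs A B. SUP x.
         ereal ((\<integral>\<omega>. total_drift \<beta> 0 n \<omega> \<partial>walk_law \<beta> x)
              + (\<integral>\<omega>. real (range_size 0 n \<omega>) \<partial>walk_law \<beta> x)))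
        \<le> ereal (C\<^sub>A\<^sub>B * (real n / ln (real n + 2))) \<and>
      (\<forall>\<beta>\<in>cookie_envs A B. \<forall>x. \<forall>T.
         stopping_time walk_filtration T \<and> (AE \<omega> in walk_law \<beta> x. T \<omega> < \<infinity>) \<longrightarrow>
         (AE \<omega> in walk_law \<beta> x.
            real_cond_exp (walk_law \<beta> x) (walk.pre_sigma T)
              (\<lambda>\<omega>. total_drift \<beta> (the_enat (T \<omega>)) n \<omega>
                   + real (range_size (the_enat (T \<omega>)) n \<omega>)) \<omega>
              \<le> C\<^sub>A\<^sub>B * (real n / ln (real n + 2))))"
    using expectation conditional unfolding Let_def K_def[symmetric] f_def
    by (intro conjI SUP_least ballI allI impI) auto
qed

end
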